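(* Let $\alpha\ge0$ and $f(x)=|x|^\alpha$. Then every oriented stable minimal hypercone in $\mathbb{R}^n$ is also $f$-stable.
   Context: A minimal hypercone is a cone $\mathcal{C}=C(\Sigma)=\{tx:t\ge0,\ x\in\Sigma\}\subset\mathbb{R}^n$ of dimension $k=n-1$ over a closed smooth minimal hypersurface $\Sigma$ of the unit sphere $S^{n-1}(1)$. Put $\mathcal{E}_f(M)=\int_M f\,d\mathcal{H}_k$ ($\mathcal{H}_k$ is $k$-dimensional Hausdorff measure). Let $D$ be the flat connection of $\mathbb{R}^n$, let $(\cdot)^\perp$ be the normal projection, let $\mathbf{B}(X,Y)=(D_XY)^\perp$, let $e_1,\dots,e_k$ be a local orthonormal tangent frame, and let $\mathbf{H}=\sum_i\mathbf{B}(e_i,e_i)$. A $C^2$ submanifold $M$ is $f$-stationary in $U=\mathbb{R}^n\setminus\{0\}$ if the first variation of $\mathcal{E}_f$ vanishes for deformations compactly supported in $U$ (equivalently $f\mathbf{H}=(Df)^\perp$ on $M\cap U$; minimal cones satisfy this for radial $f$). It is then $f$-stable if for every $C^1$ normal vector field $X$ along $M$ with compact support in $M\cap U$, $$\int_M f\Big[\sum_{i,j=1}^k\langle\mathbf{B}(e_i,e_j),X\rangle^2+\langle\mathbf{H},X\rangle^2\Big]d\mathcal{H}_k\le\int_M \Big(f\sum_{i=1}^k|(D_{e_i}X)^\perp|^2+\mathrm{Hess} f(X,X)\Big)d\mathcal{H}_k .$$ For a cone this is applied to its regular part $M=\mathcal{C}\setminus\{0\}$, i.e. with normal fields compactly supported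 away from the origin. "Stable" (for the area functional) means the same inequality with $f\equiv1$. *)

theory Defs
  imports "HOL-Analysis.Analysis" "HOL-Library.Extended_Nat"
begin

section \<open>Hausdorff measure\<close>

definition hausdorff_premeasure :: "real \<Rightarrow> nat \<Rightarrow> 'a::euclidean_space set \<Rightarrow> ennreal" where
  "hausdorff_premeasure \<delta> k A =
     (INF C \<in> {C :: nat \<Rightarrow> 'a set. A \<subseteq> (\<Union>i. C i) \<and> (\<forall>i. bounded (C i) \<and> diameter (C i) \<le> \<delta>)}.
        \<Sum>i. if C i = {} then 0 else ennreal (unit_ball_vol (real k) * (diameter (C i) / 2) ^ k))"

definition hausdorff_outer :: "nat \<Rightarrow> 'a::euclidean_space set \<Rightarrow> ennreal" where
  "hausdorff_outer k A = (SUP \<delta> \<in> {0<..}. hausdorff_premeasure \<delta> k A)"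

text \<open>The Hausdorff outer measure is a metric outer measure, hence countably additive on the
  Borel sets, so that \<^const>\<open>measure_of\<close> does not fall back to its default value.\<close>

definition hausdorff_measure :: "nat \<Rightarrow> 'a::euclidean_space measure" where
  "hausdorff_measure k = measure_of UNIV (sets borel) (hausdorff_outer k)"


section \<open>Submanifolds of Euclidean space\<close>

text \<open>\<open>Ck_on r f U\<close> is meant for open \<open>U\<close>: all iterated directional derivatives of \<open>f\<close> of order
  at most \<open>r\<close> exist and are continuous on \<open>U\<close>.\<close>

primrec Ck_on :: "nat \<Rightarrow> ('a::euclidean_space \<Rightarrow> 'b::real_normed_vector) \<Rightarrow> 'a set \<Rightarrow> bool" where
  "Ck_on 0 f U = continuous_on U f"
| "Ck_on (Suc r) f U =
     ((\<forall>x\<in>U. f differentiable (at x)) \<and> (\<forall>v. Ck_on r (\<lambda>x. frechet_derivative f (at x) v) U))"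

definition C_on :: "enat \<Rightarrow> ('a::euclidean_space \<Rightarrow> 'b::real_normed_vector) \<Rightarrow> 'a set \<Rightarrow> bool" where
  "C_on r f U \<longleftrightarrow> (\<forall>j::nat. enat j \<le> r \<longrightarrow> Ck_on j f U)"

text \<open>Embedded \<open>k\<close>-dimensional submanifolds (without boundary) of class \<open>C\<^sup>r\<close>, described by slice
  charts; \<open>r = \<infinity>\<close> is the smooth case.\<close>

definition submanifold :: "enat \<Rightarrow> nat \<Rightarrow> 'a::euclidean_space set \<Rightarrow> bool" where
  "submanifold r k M \<longleftrightarrow>
     (\<forall>p\<in>M. \<exists>U V (\<phi>::'a \<Rightarrow> 'a) \<psi> L.
        open U \<and> open V \<and> p \<in> U \<and> homeomorphism U V \<phi> \<psi> \<and> C_on r \<phi> U \<and> C_on r \<psi> V \<and>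
        subspace L \<and> dim L = k \<and> \<phi> ` (U \<inter> M) = V \<inter> L)"

definition C_along :: "enat \<Rightarrow> ('a::euclidean_space \<Rightarrow> 'b::real_normed_vector) \<Rightarrow> 'a set \<Rightarrow> bool" where
  "C_along r X M \<longleftrightarrow> (\<forall>p\<in>M. \<exists>U g. open U \<and> p \<in> U \<and> C_on r g U \<and> (\<forall>q\<in>U \<inter> M. g q = X q))"

definition tangent_space :: "'a::euclidean_space set \<Rightarrow> 'a \<Rightarrow> 'a set" where
  "tangent_space M p =
     {v. \<exists>(\<gamma>::real \<Rightarrow> 'a) \<epsilon>. \<epsilon> > 0 \<and> \<gamma> 0 = p \<and> (\<forall>t. \<bar>t\<bar> < \<epsilon> \<longrightarrow> \<gamma> t \<in> M) \<and>
         (\<gamma> has_vector_derivative v) (at 0)}"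

definition normal_space :: "'a::euclidean_space set \<Rightarrow> 'a \<Rightarrow> 'a set" where
  "normal_space M p = {w. \<forall>v\<in>tangent_space M p. w \<bullet> v = 0}"

definition orth_proj :: "'a::euclidean_space set \<Rightarrow> 'a \<Rightarrow> 'a" where
  "orth_proj S v = (THE u. u \<in> S \<and> (\<forall>w\<in>S. (v - u) \<bullet> w = 0))"

definition normal_proj :: "'a::euclidean_space set \<Rightarrow> 'a \<Rightarrow> 'a \<Rightarrow> 'a" where
  "normal_proj M p = orth_proj (normal_space M p)"

text \<open>A vector at \<open>p\<close> that is tangent to \<open>M\<close> is a limit direction of \<open>M\<close>, so on tangent vectors all
  Frechet derivatives of \<open>Y\<close> within \<open>M\<close> agree; \<open>D_along M Y p u\<close> is therefore the derivative
  \<open>D\<^sub>u Y\<close> of the field \<open>Y\<close> along \<open>M\<close> when \<open>u \<in> tangent_space M p\<close>.\<close>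

definition D_along ::
    "'a::euclidean_space set \<Rightarrow> ('a \<Rightarrow> 'b::real_normed_vector) \<Rightarrow> 'a \<Rightarrow> 'a \<Rightarrow> 'b" where
  "D_along M Y p u = frechet_derivative Y (at p within M) u"

text \<open>\<open>B(u,v) = (D\<^sub>u Y)\<^sup>\<bottom>\<close> for any local tangent field \<open>Y\<close> extending \<open>v\<close>; the value does not depend
  on the extension.\<close>

definition second_ff :: "'a::euclidean_space set \<Rightarrow> 'a \<Rightarrow> 'a \<Rightarrow> 'a \<Rightarrow> 'a" where
  "second_ff M p u v =
     (THE w. \<exists>Y W. open W \<and> p \<in> W \<and> C_along 1 Y (M \<inter> W) \<and>
        (\<forall>q\<in>M \<inter> W. Y q \<in> tangent_space M q) \<and> Y p = v \<and>
        w = normal_proj M p (D_along M Y p u))"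

text \<open>A choice of orthonormal basis of each tangent space, as a set. The sums over it below are
  traces, so they do not depend on the choice.\<close>

definition tangent_frame :: "'a::euclidean_space set \<Rightarrow> 'a \<Rightarrow> 'a set" where
  "tangent_frame M p =
     (SOME E. E \<subseteq> tangent_space M p \<and> pairwise orthogonal E \<and> (\<forall>e\<in>E. norm e = 1) \<and>
        span E = tangent_space M p)"

definition mean_curvature :: "'a::euclidean_space set \<Rightarrow> 'a \<Rightarrow> 'a" where
  "mean_curvature M p = (\<Sum>e\<in>tangent_frame M p. second_ff M p e e)"

definition unit_normal_field :: "'a::euclidean_space set \<Rightarrow> ('a \<Rightarrow> 'a) \<Rightarrow> bool" where
  "unit_normal_field M \<nu> \<longleftrightarrow>
     continuous_on M \<nu> \<and> (\<forall>p\<in>M. \<nu> p \<in> normal_space M p \<and> norm (\<nu> p) = 1)"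


section \<open>Stationarity and stability for weighted area\<close>

definition gradient :: "('a::euclidean_space \<Rightarrow> real) \<Rightarrow> 'a \<Rightarrow> 'a" where
  "gradient f p = (THE D. GDERIV f p :> D)"

definition hessian :: "('a::euclidean_space \<Rightarrow> real) \<Rightarrow> 'a \<Rightarrow> 'a \<Rightarrow> 'a \<Rightarrow> real" where
  "hessian f p v w =
     frechet_derivative (\<lambda>q. frechet_derivative f (at q) v) (at p) w"

text \<open>Stationarity in the complement of the origin, as the Euler-Lagrange equation
  \<open>f H = (D f)\<^sup>\<bottom>\<close> of the weighted area \<open>\<integral> f\<close> over \<open>M\<close>.\<close>

definition f_stationary :: "nat \<Rightarrow> ('a::euclidean_space \<Rightarrow> real) \<Rightarrow> 'a set \<Rightarrow> bool" where
  "f_stationary k f M \<longleftrightarrow>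
     submanifold 2 k M \<and>
     (\<forall>p\<in>M - {0}. f p *\<^sub>R mean_curvature M p = normal_proj M p (gradient f p))"

definition normal_test_field :: "'a::euclidean_space set \<Rightarrow> ('a \<Rightarrow> 'a) \<Rightarrow> bool" where
  "normal_test_field M X \<longleftrightarrow>
     C_along 1 X M \<and> (\<forall>p\<in>M. X p \<in> normal_space M p) \<and>
     (\<exists>K. compact K \<and> K \<subseteq> M - {0} \<and> (\<forall>p\<in>M - K. X p = 0))"

definition f_stable :: "nat \<Rightarrow> ('a::euclidean_space \<Rightarrow> real) \<Rightarrow> 'a set \<Rightarrow> bool" where
  "f_stable k f M \<longleftrightarrow>
     f_stationary k f M \<and>
     (\<forall>X. normal_test_field M X \<longrightarrow>
        (LINT p:M|hausdorff_measure k.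
            f p * ((\<Sum>e\<in>tangent_frame M p. \<Sum>e'\<in>tangent_frame M p. (second_ff M p e e' \<bullet> X p)\<^sup>2)
                   + (mean_curvature M p \<bullet> X p)\<^sup>2))
        \<le> (LINT p:M|hausdorff_measure k.
            f p * (\<Sum>e\<in>tangent_frame M p. (norm (normal_proj M p (D_along M X p e)))\<^sup>2)
            + hessian f p (X p) (X p)))"

abbreviation area_stable :: "nat \<Rightarrow> 'a::euclidean_space set \<Rightarrow> bool" where
  "area_stable k M \<equiv> f_stable k (\<lambda>_. 1) M"


section \<open>Minimal hypercones\<close>

text \<open>The second fundamental form of \<open>\<Sigma>\<close> inside the sphere is the component of \<open>B\<close> tangent to the
  sphere; minimality means that the trace of this component vanishes.\<close>

definition minimal_in_sphere :: "'a::euclidean_space set \<Rightarrow> bool" where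
  "minimal_in_sphere \<Sigma> \<longleftrightarrow>
     (\<forall>p\<in>\<Sigma>. orth_proj (tangent_space (sphere 0 1) p) (mean_curvature \<Sigma> p) = 0)"

definition cone_over :: "'a::euclidean_space set \<Rightarrow> 'a set" where
  "cone_over \<Sigma> = {t *\<^sub>R x | t x. 0 \<le> t \<and> x \<in> \<Sigma>}"

definition minimal_hypercone :: "'a::euclidean_space set \<Rightarrow> bool" where
  "minimal_hypercone C \<longleftrightarrow>
     2 \<le> DIM('a) \<and>
     (\<exists>\<Sigma>. compact \<Sigma> \<and> \<Sigma> \<subseteq> sphere 0 1 \<and> submanifold \<infinity> (DIM('a) - 2) \<Sigma> \<and>
        minimal_in_sphere \<Sigma> \<and> C = cone_over \<Sigma>)"

end

theory Submission
  imports Defs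
begin

text \<open>Write \<open>r = norm x\<close>. Testing the stability of the cone with \<open>Y = r powr (\<alpha>/2) *\<^sub>R X\<close> turns the
  curvature side into that of the weighted inequality for \<open>X\<close>. Since \<open>x\<close> is tangent and \<open>X\<close> normal,
  the weighted right-hand side exceeds the one of \<open>Y\<close> pointwise by
  \<open>h = \<alpha> * (\<alpha>/4 * w - d/2)\<close>, where \<open>w = r powr (\<alpha> - 2) * |X|\<^sup>2\<close> and \<open>d\<close> is the derivative of \<open>w\<close> in the
  direction \<open>x\<close>. The \<open>k\<close>-homogeneity of Hausdorff measure under dilations of the cone gives
  \<open>\<integral>d = - k \<integral>w \<le> 0\<close>, hence \<open>\<integral>h \<ge> 0\<close>.\<close>

section \<open>Hausdorff measure\<close>

text \<open>Two obstacles shape the argument. The integral of a non-integrable function is 0, so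
  stability inequalities cannot be combined by linearity as long as integrability of the curvature
  and gradient terms is open. Hence everything is compared pointwise: the curvature sides coincide,
  the other sides differ by \<open>h\<close>, and only \<open>h\<close>, continuous on the cone and
  zero off a compact set, is ever split into integrals. The second obstacle is the sign of the
  integral of \<open>d\<close>. In place of a divergence theorem, \<open>w\<close> is compared with
  its dilates: each radial difference quotient of \<open>w\<close> already has a nonpositive
  integral, and dominated convergence passes this to the limit. A majorant exists because compact
  subsets of the cone have finite measure, which is the reason for the Lipschitz and grid estimates
  and for the work with charts. The Hessian contributes \<open>\<alpha> * w\<close>. It disappears
  from \<open>h\<close> because expressing the cross term of the product rule through
  \<open>d\<close> leaves exactly \<open>- \<alpha> * w\<close> behind.\<close>

lemma hausdorff_premeasure_lipschitz:
  assumes f: "L-lipschitz_on A f" and L: "L > 0" and \<delta>: "\<delta> > 0"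
  shows "hausdorff_premeasure (L * \<delta>) k (f ` A) \<le> ennreal (L ^ k) * hausdorff_premeasure \<delta> k A"
proof -
  \<comment> \<open>Dividing by the constant leaves the infimum alone on the right, so the estimate
    can be made cover by cover.\<close>
  have "hausdorff_premeasure (L * \<delta>) k (f ` A) / ennreal (L ^ k) \<le> hausdorff_premeasure \<delta> k A"
    unfolding hausdorff_premeasure_def[of \<delta> k A]
  proof (rule INF_greatest)
    fix C :: "nat \<Rightarrow> 'a set"
    assume "C \<in> {C. A \<subseteq> (\<Union>i. C i) \<and> (\<forall>i. bounded (C i) \<and> diameter (C i) \<le> \<delta>)}"
    then have cov: "A \<subseteq> (\<Union>i. C i)" and bd: "\<And>i. bounded (C i)" and dm: "\<And>i. diameter (C i) \<le> \<delta>"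
      by auto
    \<comment> \<open>The trace on \<open>A\<close> is taken because \<open>f\<close> is Lipschitz
      only there. It may be empty although \<open>C i\<close> is not, which only lowers the
      sum.\<close>
    define S where "S i = f ` (C i \<inter> A)" for i
    have d0: "0 \<le> diameter (C i)" for i
      using diameter_ge_0[OF bd] .
    have dist: "norm (x - y) \<le> L * diameter (C i)" if xy: "x \<in> S i" "y \<in> S i" for x y i
    proof -
      obtain a b where ab: "a \<in> C i" "a \<in> A" "x = f a" "b \<in> C i" "b \<in> A" "y = f b"
        using xy by (auto simp: S_def)
      then have "dist (f a) (f b) \<le> L * dist a b"
        by (intro lipschitz_onD[OF f])
      also have "\<dots> \<le> L * diameter (C i)"
        using L ab by (intro mult_left_mono diameter_bounded_bound bd) auto
      finally show ?thesis using ab by (simp add: dist_norm)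
    qed
    have diam: "diameter (S i) \<le> L * diameter (C i)" for i
      using dist d0[of i] L by (intro diameter_le) auto
    have "bounded (S i)" for i
      using dist by (auto simp: bounded_two_points dist_norm)
    moreover have "diameter (S i) \<le> L * \<delta>" for i
      using diam[of i] dm[of i] L by (meson mult_le_cancel_left_pos order_trans)
    moreover have "f ` A \<subseteq> (\<Union>i. S i)"
      using cov by (fastforce simp: S_def)
    ultimately have "hausdorff_premeasure (L * \<delta>) k (f ` A) \<le>
        (\<Sum>i. if S i = {} then 0 else ennreal (unit_ball_vol (real k) * (diameter (S i) / 2) ^ k))"
      unfolding hausdorff_premeasure_def by (intro INF_lower) auto
    also have "\<dots> \<le> (\<Sum>i. ennreal (L ^ k) *
        (if C i = {} then 0 else ennreal (unit_ball_vol (real k) * (diameter (C i) / 2) ^ k)))"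
    proof (intro suminf_le)
      fix i
      show "(if S i = {} then 0 else ennreal (unit_ball_vol (real k) * (diameter (S i) / 2) ^ k))
        \<le> ennreal (L ^ k) *
          (if C i = {} then 0 else ennreal (unit_ball_vol (real k) * (diameter (C i) / 2) ^ k))"
      proof (cases "S i = {}")
        case False
        then have "C i \<noteq> {}" by (auto simp: S_def)
        have "bounded (S i)" by fact
        then have "(diameter (S i) / 2) ^ k \<le> (L * (diameter (C i) / 2)) ^ k"
          using diam[of i] diameter_ge_0[of "S i"] by (intro power_mono) auto
        then have "unit_ball_vol (real k) * (diameter (S i) / 2) ^ k
            \<le> unit_ball_vol (real k) * (L * (diameter (C i) / 2)) ^ k"
          by (rule mult_left_mono) simp
        also have "\<dots> = L ^ k * (unit_ball_vol (real k) * (diameter (C i) / 2) ^ k)"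
          by (simp only: power_mult_distrib mult_ac)
        finally have "unit_ball_vol (real k) * (diameter (S i) / 2) ^ k
            \<le> L ^ k * (unit_ball_vol (real k) * (diameter (C i) / 2) ^ k)" .
        then show ?thesis
          using False \<open>C i \<noteq> {}\<close> L d0[of i] by (simp add: ennreal_mult'[symmetric] ennreal_leI)
      qed auto
    qed auto
    also have "\<dots> = ennreal (L ^ k) *
        (\<Sum>i. if C i = {} then 0 else ennreal (unit_ball_vol (real k) * (diameter (C i) / 2) ^ k))"
      by simp
    finally show "hausdorff_premeasure (L * \<delta>) k (f ` A) / ennreal (L ^ k) \<le>
        (\<Sum>i. if C i = {} then 0 else ennreal (unit_ball_vol (real k) * (diameter (C i) / 2) ^ k))"
      using L by (intro divide_le_posI_ennreal) (auto simp: mult_ac)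
  qed
  then have "ennreal (L ^ k) * (hausdorff_premeasure (L * \<delta>) k (f ` A) / ennreal (L ^ k))
      \<le> ennreal (L ^ k) * hausdorff_premeasure \<delta> k A"
    by (rule mult_left_mono) auto
  then show ?thesis
    using L by (simp add: ennreal_times_divide mult.commute[of "ennreal (L ^ k)"]
        ennreal_mult_divide_eq)
qed

lemma hausdorff_outer_lipschitz:
  assumes f: "L-lipschitz_on A f" and L: "L > 0"
  shows "hausdorff_outer k (f ` A) \<le> ennreal (L ^ k) * hausdorff_outer k A"
  unfolding hausdorff_outer_def[of k "f ` A"]
proof (rule SUP_least)
  fix \<delta> :: real assume \<delta>: "\<delta> \<in> {0<..}"
  then have "hausdorff_premeasure \<delta> k (f ` A) \<le> ennreal (L ^ k) * hausdorff_premeasure (\<delta> / L) k A"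
    using hausdorff_premeasure_lipschitz[OF f L, of "\<delta> / L" k] L by simp
  also have "\<dots> \<le> ennreal (L ^ k) * hausdorff_outer k A"
    using \<delta> L unfolding hausdorff_outer_def by (intro mult_left_mono SUP_upper) auto
  finally show "hausdorff_premeasure \<delta> k (f ` A) \<le> ennreal (L ^ k) * hausdorff_outer k A" .
qed

lemma hausdorff_outer_mono:
  assumes "A \<subseteq> B"
  shows "hausdorff_outer k A \<le> hausdorff_outer k B"
  unfolding hausdorff_outer_def hausdorff_premeasure_def
  using assms by (intro SUP_subset_mono INF_superset_mono order_refl) auto

text \<open>The Lipschitz bound for the dilation and for its inverse give the two inequalities,
  since the constants \<open>t ^ k\<close> and \<open>(1 / t) ^ k\<close> multiply to 1.\<close>

lemma hausdorff_outer_scaleR: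
  fixes A :: "'a::euclidean_space set"
  assumes t: "t > 0"
  shows "hausdorff_outer k ((*\<^sub>R) t ` A) = ennreal (t ^ k) * hausdorff_outer k A"
proof (rule antisym)
  have lip: "s-lipschitz_on B ((*\<^sub>R) s)" if "s > 0" for s and B :: "'a set"
    using that by (intro lipschitz_onI) (auto simp: dist_norm simp flip: scaleR_diff_right)
  show "hausdorff_outer k ((*\<^sub>R) t ` A) \<le> ennreal (t ^ k) * hausdorff_outer k A"
    by (rule hausdorff_outer_lipschitz[OF lip]) (use t in auto)
  have "hausdorff_outer k A = hausdorff_outer k ((*\<^sub>R) (1 / t) ` ((*\<^sub>R) t ` A))"
    using t by (simp add: image_image)
  also have "\<dots> \<le> ennreal ((1 / t) ^ k) * hausdorff_outer k ((*\<^sub>R) t ` A)"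
    by (rule hausdorff_outer_lipschitz[OF lip]) (use t in auto)
  finally have "ennreal (t ^ k) * hausdorff_outer k A
      \<le> ennreal (t ^ k) * (ennreal ((1 / t) ^ k) * hausdorff_outer k ((*\<^sub>R) t ` A))"
    by (rule mult_left_mono) auto
  also have "\<dots> = hausdorff_outer k ((*\<^sub>R) t ` A)"
    using t by (simp add: mult.assoc[symmetric] ennreal_mult'[symmetric] power_divide)
  finally show "ennreal (t ^ k) * hausdorff_outer k A \<le> hausdorff_outer k ((*\<^sub>R) t ` A)" .
qed

section \<open>Finiteness on bounded pieces of a subspace\<close>

lemma hausdorff_premeasure_le_finite_cover:
  assumes F: "finite F" and cov: "A \<subseteq> (\<Union>i\<in>F. S i)"
    and S: "\<And>i. i \<in> F \<Longrightarrow> bounded (S i)" "\<And>i. i \<in> F \<Longrightarrow> diameter (S i) \<le> d"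
    and d: "0 \<le> d" "d \<le> \<delta>"
  shows "hausdorff_premeasure \<delta> k A \<le> ennreal (card F * (unit_ball_vol (real k) * (d / 2) ^ k))"
proof -
  obtain h where h: "bij_betw h {0..<card F} F"
    using ex_bij_betw_nat_finite[OF F] by blast
  then have hF: "h i \<in> F" if "i < card F" for i
    using that bij_betwE by fastforce
  \<comment> \<open>Padding with empty sets is free by the convention in the premeasure; for
    \<open>k = 0\<close> the power of a zero diameter would still be 1.\<close>
  define C where "C i = (if i < card F then S (h i) else {})" for i
  let ?s = "\<lambda>i. if C i = {} then 0 else ennreal (unit_ball_vol (real k) * (diameter (C i) / 2) ^ k)"
  have C: "bounded (C i)" "diameter (C i) \<le> d" for i
    using S hF d by (auto simp: C_def)
  have "A \<subseteq> (\<Union>i. C i)"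
  proof
    fix x assume "x \<in> A"
    then obtain j where "j \<in> F" "x \<in> S j" using cov by auto
    moreover then obtain i where "i < card F" "h i = j"
      using h by (metis atLeastLessThan_iff bij_betw_iff_bijections)
    ultimately show "x \<in> (\<Union>i. C i)" by (auto simp: C_def)
  qed
  then have "hausdorff_premeasure \<delta> k A \<le> (\<Sum>i. ?s i)"
    unfolding hausdorff_premeasure_def using C d by (intro INF_lower) (auto intro: order_trans)
  also have "\<dots> = (\<Sum>i<card F. ?s i)"
    by (intro suminf_finite) (auto simp: C_def)
  also have "\<dots> \<le> (\<Sum>i<card F. ennreal (unit_ball_vol (real k) * (d / 2) ^ k))"
  proof (intro sum_mono)
    fix i
    have "unit_ball_vol (real k) * (diameter (C i) / 2) ^ k \<le> unit_ball_vol (real k) * (d / 2) ^ k"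
      using C[of i] diameter_ge_0[of "C i"] by (intro mult_left_mono power_mono) auto
    then show "?s i \<le> ennreal (unit_ball_vol (real k) * (d / 2) ^ k)"
      by (simp add: ennreal_leI)
  qed
  also have "\<dots> = ennreal (card F * (unit_ball_vol (real k) * (d / 2) ^ k))"
    by (simp add: ennreal_mult'' ennreal_of_nat_eq_real_of_nat d ennreal_mult')
  finally show ?thesis .
qed

text \<open>A grid of mesh 1/N in orthonormal coordinates of \<open>L\<close> needs O(N^k) cells of
  diameter O(1/N), so the covering sums stay bounded as N grows.\<close>

lemma hausdorff_outer_bounded_subspace:
  fixes L :: "'a::euclidean_space set"
  assumes L: "subspace L" "dim L = k" and A: "bounded A" "A \<subseteq> L"
  shows "hausdorff_outer k A < \<infinity>"
proof -
  obtain B where B: "B \<subseteq> L" "pairwise orthogonal B" "\<And>x. x \<in> B \<Longrightarrow> norm x = 1"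
      "independent B" "card B = k" "span B = L"
    using orthonormal_basis_subspace[OF L(1)] L(2) by metis
  have fB: "finite B" using B(4) independent_imp_finite by blast
  obtain r where r: "\<And>x. x \<in> A \<Longrightarrow> norm x \<le> r" using A(1) by (auto simp: bounded_iff)
  \<comment> \<open>\<open>R \<ge> 1\<close> serves to absorb the extra 1 in the cell count: 2NR + 1
    is at most 3NR.\<close>
  obtain R :: nat where R: "R \<ge> 1" "\<And>x. x \<in> A \<Longrightarrow> norm x \<le> real R"
  proof
    show "nat \<lceil>max r 1\<rceil> \<ge> 1" by linarith
    show "norm x \<le> real (nat \<lceil>max r 1\<rceil>)" if "x \<in> A" for x
      using r[OF that] by linarith
  qed
  \<comment> \<open>At most (3NR)^k cells of diameter at most k/N will occur; the powers of N
    cancel.\<close>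
  define K where "K = unit_ball_vol (real k) * (3 * R * k / 2) ^ k"
  have "hausdorff_premeasure \<delta> k A \<le> ennreal K" if "\<delta> > 0" for \<delta>
  proof -
    obtain N :: nat where N: "real k / \<delta> < real N" using reals_Archimedean2 by blast
    have "0 \<le> real k / \<delta>" using that by simp
    then have N0: "N > 0" using N by (cases N) auto
    have kN: "real k / real N \<le> \<delta>"
      using N N0 that by (simp add: field_simps)
    define m where "m = int N * int R"
    have m0: "m \<ge> 1"
      using mult_mono[of 1 "int N" 1 "int R"] N0 R(1) by (simp add: m_def)
    \<comment> \<open>\<open>c x\<close> labels the grid cell of \<open>x\<close>. Restriction to
      \<open>B\<close> makes it extensional, hence an element of the finite product
      \<open>F\<close>.\<close>
    define c where "c x = (\<lambda>b\<in>B. \<lfloor>real N * (x \<bullet> b)\<rfloor>)" for x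
    define F where "F = (PiE B (\<lambda>_. {-m..m}))"
    define S where "S g = {x \<in> A. c x = g}" for g
    have bounds: "c x b \<in> {-m..m}" if "x \<in> A" "b \<in> B" for x b
    proof -
      have "\<bar>x \<bullet> b\<bar> \<le> real R"
        using Cauchy_Schwarz_ineq2[of x b] B(3)[OF that(2)] R(2)[OF that(1)] by simp
      then have "\<bar>real N * (x \<bullet> b)\<bar> \<le> of_int m"
        by (simp add: m_def abs_mult mult_left_mono)
      then show ?thesis using that by (simp add: c_def) linarith
    qed
    have "A \<subseteq> (\<Union>g\<in>F. S g)"
      using bounds by (auto simp: S_def F_def c_def PiE_iff)
    moreover have "finite F" using fB by (auto simp: F_def intro: finite_PiE)
    moreover have "bounded (S g)" for g
      by (rule bounded_subset[OF A(1)]) (auto simp: S_def)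
    moreover have "diameter (S g) \<le> real k / real N" for g
    proof (rule diameter_le)
      fix x y assume xy: "x \<in> S g" "y \<in> S g"
      then have "x - y \<in> span B" using A(2) B(6) L(1) by (auto simp: S_def intro: subspace_diff)
      then have "norm (x - y) = norm (\<Sum>b\<in>B. ((x - y) \<bullet> b) *\<^sub>R b)"
        using orthonormal_basis_expand[of B "x - y"] B fB by simp
      \<comment> \<open>Within a cell each coordinate varies by at most 1/N; adding up the
        coordinates gives the diameter bound k/N.\<close>
      also have "\<dots> \<le> (\<Sum>b\<in>B. 1 / real N)"
      proof (rule sum_norm_le)
        fix b assume b: "b \<in> B"
        have "c x b = c y b" using xy by (simp add: S_def)
        then have "\<lfloor>real N * (x \<bullet> b)\<rfloor> = \<lfloor>real N * (y \<bullet> b)\<rfloor>" using b by (simp add: c_def)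
        then have "\<bar>real N * (x \<bullet> b) - real N * (y \<bullet> b)\<bar> \<le> 1" by linarith
        moreover have "real N * \<bar>(x - y) \<bullet> b\<bar> = \<bar>real N * (x \<bullet> b) - real N * (y \<bullet> b)\<bar>"
          by (simp add: inner_diff_left abs_mult flip: right_diff_distrib)
        ultimately have "real N * \<bar>(x - y) \<bullet> b\<bar> \<le> 1" by simp
        then show "norm (((x - y) \<bullet> b) *\<^sub>R b) \<le> 1 / real N"
          using N0 B(3)[OF b] by (simp add: field_simps)
      qed
      finally show "norm (x - y) \<le> real k / real N" using B(5) by simp
    qed simp
    ultimately have "hausdorff_premeasure \<delta> k A
        \<le> ennreal (card F * (unit_ball_vol (real k) * (real k / real N / 2) ^ k))"
      using kN by (intro hausdorff_premeasure_le_finite_cover) auto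
    also have "\<dots> \<le> ennreal K"
    proof (rule ennreal_leI)
      have "card F = card {-m..m} ^ k" using fB B(5) by (simp add: F_def card_PiE)
      then have "real (card F) = (2 * real N * real R + 1) ^ k"
        using m0 by (simp add: m_def algebra_simps nat_add_distrib)
      also have "\<dots> \<le> (3 * real N * real R) ^ k"
      proof (rule power_mono)
        have "1 \<le> real_of_int m" using m0 by simp
        then show "2 * real N * real R + 1 \<le> 3 * real N * real R" by (simp add: m_def)
      qed simp
      finally have "real (card F) * (unit_ball_vol (real k) * (real k / real N / 2) ^ k)
          \<le> (3 * real N * real R) ^ k * (unit_ball_vol (real k) * (real k / real N / 2) ^ k)"
        by (rule mult_right_mono) simp
      also have "\<dots> = unit_ball_vol (real k) * (3 * real N * real R * (real k / real N / 2)) ^ k"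
        by (simp only: power_mult_distrib mult_ac)
      also have "3 * real N * real R * (real k / real N / 2) = 3 * R * k / 2"
        using N0 by simp
      finally show "real (card F) * (unit_ball_vol (real k) * (real k / real N / 2) ^ k) \<le> K"
        by (simp add: K_def)
    qed
    finally show ?thesis .
  qed
  then have "hausdorff_outer k A \<le> ennreal K"
    unfolding hausdorff_outer_def by (intro SUP_least) auto
  then show ?thesis
    using ennreal_less_top le_less_trans by (metis infinity_ennreal_def)
qed

section \<open>Passage to the measure, and its behaviour under dilations\<close>

lemma sets_hausdorff_measure [measurable_cong, simp]: "sets (hausdorff_measure k) = sets borel"
  using sets.sigma_sets_eq[of borel] by (simp add: hausdorff_measure_def sets_measure_of_conv)

lemma space_hausdorff_measure [simp]: "space (hausdorff_measure k) = UNIV"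
  by (simp add: hausdorff_measure_def)

text \<open>The case distinction accounts for the zero measure that \<^const>\<open>measure_of\<close> returns when its
  argument is not countably additive; everything below holds in that case as well, so
  Caratheodory's theorem is not needed.\<close>

lemma emeasure_hausdorff_measure:
  fixes A :: "'a::euclidean_space set"
  assumes "A \<in> sets borel"
  shows "emeasure (hausdorff_measure k) A =
    (if measure_space UNIV (sets (borel :: 'a measure)) (hausdorff_outer k) then hausdorff_outer k A else 0)"
  unfolding hausdorff_measure_def using assms sets.sigma_sets_eq[of "borel :: 'a measure"] by (simp add: emeasure_measure_of_conv)

lemma emeasure_hausdorff_measure_le:
  assumes "A \<in> sets borel"
  shows "emeasure (hausdorff_measure k) A \<le> hausdorff_outer k A"
  by (simp add: emeasure_hausdorff_measure assms)

text \<open>The preimage under dilation by \<open>t\<close> is the dilation by \<open>1 / t\<close>,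
  so homogeneity of the outer measure turns the pushforward into a constant density.\<close>

lemma distr_hausdorff_measure_scaleR:
  assumes t: "t > 0"
  shows "distr (hausdorff_measure k) borel ((*\<^sub>R) t) =
    density (hausdorff_measure k :: 'a::euclidean_space measure) (\<lambda>_. ennreal ((1 / t) ^ k))"
proof (rule measure_eqI)
  fix A :: "'a set" assume "A \<in> sets (distr (hausdorff_measure k) borel ((*\<^sub>R) t))"
  then have A: "A \<in> sets borel" by simp
  have img: "(*\<^sub>R) t -` A = (*\<^sub>R) (1 / t) ` A"
    using t by (force simp: image_iff)
  have A': "(*\<^sub>R) t -` A \<in> sets borel"
    using measurable_sets[of "(*\<^sub>R) t" borel borel A] A by simp
  have "emeasure (distr (hausdorff_measure k) borel ((*\<^sub>R) t)) A
      = emeasure (hausdorff_measure k) ((*\<^sub>R) t -` A)"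
    using A by (subst emeasure_distr) auto
  also have "\<dots> = ennreal ((1 / t) ^ k) * emeasure (hausdorff_measure k) A"
    using A A' t hausdorff_outer_scaleR[of "1 / t" k A]
    by (simp add: emeasure_hausdorff_measure img)
  also have "\<dots> = emeasure (density (hausdorff_measure k) (\<lambda>_. ennreal ((1 / t) ^ k))) A"
    using A by (subst emeasure_density_const) auto
  finally show "emeasure (distr (hausdorff_measure k) borel ((*\<^sub>R) t)) A
    = emeasure (density (hausdorff_measure k) (\<lambda>_. ennreal ((1 / t) ^ k))) A" .
qed simp

lemma integral_hausdorff_measure_scaleR:
  fixes w :: "'a::euclidean_space \<Rightarrow> real"
  assumes t: "t > 0" and w: "w \<in> borel_measurable borel"
  shows "(LINT p|hausdorff_measure k. w (t *\<^sub>R p)) = (1 / t) ^ k * (LINT p|hausdorff_measure k. w p)"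
proof -
  have "(LINT p|hausdorff_measure k. w (t *\<^sub>R p)) = (LINT p|distr (hausdorff_measure k) borel ((*\<^sub>R) t). w p)"
    using w by (subst integral_distr) auto
  also have "\<dots> = (LINT p|density (hausdorff_measure k) (\<lambda>_. ennreal ((1 / t) ^ k)). w p)"
    by (simp only: distr_hausdorff_measure_scaleR[OF t])
  also have "\<dots> = (1 / t) ^ k * (LINT p|hausdorff_measure k. w p)"
    using w t by (subst integral_density) auto
  finally show ?thesis .
qed

section \<open>Submanifolds\<close>

lemma C_on_mono: "C_on s f U" if "C_on r f U" "s \<le> r"
  using that by (auto simp: C_on_def intro: order_trans)

lemma C_on_1_iff:
  "C_on 1 f U \<longleftrightarrow> (\<forall>x\<in>U. f differentiable at x) \<and>
     (\<forall>v. continuous_on U (\<lambda>x. frechet_derivative f (at x) v))"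
proof -
  have "enat j \<le> 1 \<longleftrightarrow> j = 0 \<or> j = Suc 0" for j
    by (auto simp: one_enat_def)
  then have "C_on 1 f U \<longleftrightarrow> Ck_on 0 f U \<and> Ck_on (Suc 0) f U"
    by (auto simp: C_on_def)
  moreover have "continuous_on U f" if "\<forall>x\<in>U. f differentiable at x"
    using that by (simp add: continuous_at_imp_continuous_on differentiable_imp_continuous_within)
  ultimately show ?thesis by auto
qed

lemma C_on_1_has_derivative:
  "C_on 1 f U \<Longrightarrow> x \<in> U \<Longrightarrow> (f has_derivative frechet_derivative f (at x)) (at x)"
  by (simp add: C_on_1_iff frechet_derivative_works)

text \<open>Meant for quantities given by a formula only through a local extension, which changes
  from point to point.\<close>

lemma continuous_on_locally_eq:
  fixes f :: "'a::t2_space \<Rightarrow> 'b::topological_space"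
  assumes "\<And>p. p \<in> M \<Longrightarrow> \<exists>U g. open U \<and> p \<in> U \<and> continuous_on (U \<inter> M) g \<and> (\<forall>q\<in>U \<inter> M. g q = f q)"
  shows "continuous_on M f"
  unfolding continuous_on_eq_continuous_within
proof
  fix p assume p: "p \<in> M"
  then obtain U g where U: "open U" "p \<in> U" "continuous_on (U \<inter> M) g" "\<forall>q\<in>U \<inter> M. g q = f q"
    using assms by blast
  then have "continuous_on (U \<inter> M) f" by (metis continuous_on_cong)
  then have "continuous (at p within U \<inter> M) f"
    using p U(2) by (simp add: continuous_on_eq_continuous_within)
  moreover have "at p within U \<inter> M = at p within M"
    using U(1,2) by (intro at_within_nhd[of p U]) auto
  ultimately show "continuous (at p within M) f" by simp
qed

section \<open>Orthogonal projection onto normal spaces\<close>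

lemma subspace_normal_space: "subspace (normal_space M p)"
  by (auto simp: subspace_def normal_space_def inner_add_left)

lemma orth_proj_eqI:
  assumes "subspace S" "u \<in> S" "\<And>w. w \<in> S \<Longrightarrow> (v - u) \<bullet> w = 0"
  shows "orth_proj S v = u"
  unfolding orth_proj_def
proof (rule the_equality)
  fix u' assume u': "u' \<in> S \<and> (\<forall>w\<in>S. (v - u') \<bullet> w = 0)"
  then have "u' - u \<in> S" using assms by (auto intro: subspace_diff)
  then have "(v - u) \<bullet> (u' - u) - (v - u') \<bullet> (u' - u) = 0" using u' assms by auto
  then have "(u' - u) \<bullet> (u' - u) = 0" by (simp add: inner_diff_left)
  then show "u' = u" by simp
qed (use assms in auto)

lemma orth_proj_props:
  fixes S :: "'a::euclidean_space set"
  assumes S: "subspace S"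
  shows "orth_proj S v \<in> S \<and> (\<forall>w\<in>S. (v - orth_proj S v) \<bullet> w = 0)"
proof -
  have span: "span S = S" using S by (simp add: span_eq_iff)
  obtain y z where yz: "y \<in> span S" "\<And>w. w \<in> span S \<Longrightarrow> orthogonal z w" "v = y + z"
    using orthogonal_subspace_decomp_exists by blast
  then have "orth_proj S v = y"
    using S by (intro orth_proj_eqI) (auto simp: orthogonal_def span)
  then show ?thesis using yz by (auto simp: orthogonal_def span)
qed

text \<open>The argument has the shape the product rule gives for a rescaled normal field: a
  multiple of the derivative plus a multiple of the field, which the projection leaves
  alone.\<close>

lemma orth_proj_scaled_add:
  assumes S: "subspace S" and x: "x \<in> S"
  shows "orth_proj S (a *\<^sub>R v + b *\<^sub>R x) = a *\<^sub>R orth_proj S v + b *\<^sub>R x"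
proof (rule orth_proj_eqI[OF S])
  show "a *\<^sub>R orth_proj S v + b *\<^sub>R x \<in> S"
    using orth_proj_props[OF S] x S by (auto intro: subspace_add subspace_scale)
  fix w assume "w \<in> S"
  then have "a * ((v - orth_proj S v) \<bullet> w) = 0" using orth_proj_props[OF S] by simp
  then show "(a *\<^sub>R v + b *\<^sub>R x - (a *\<^sub>R orth_proj S v + b *\<^sub>R x)) \<bullet> w = 0"
    by (simp add: inner_diff_left algebra_simps)
qed

lemma inner_orth_proj:
  assumes "subspace S" "x \<in> S"
  shows "orth_proj S v \<bullet> x = v \<bullet> x"
  using orth_proj_props[OF assms(1), of v] assms(2) by (simp add: inner_diff_left)

lemma normal_proj_tangent:
  assumes "v \<in> tangent_space M p"
  shows "normal_proj M p v = 0"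
  unfolding normal_proj_def
  using assms by (intro orth_proj_eqI subspace_normal_space subspace_0)
    (auto simp: normal_space_def inner_commute)

section \<open>Derivatives along curves and tangent spaces\<close>

lemma has_derivative_within_curve:
  assumes f: "(f has_derivative D) (at p within M)" and p: "\<gamma> 0 = p"
    and \<gamma>: "(\<gamma> has_vector_derivative v) (at 0)" "\<epsilon> > 0" "\<And>t. \<bar>t\<bar> < \<epsilon> \<Longrightarrow> \<gamma> t \<in> M"
  shows "((\<lambda>t. f (\<gamma> t)) has_vector_derivative D v) (at 0)"
proof -
  \<comment> \<open>On an open interval around 0 the derivative within is the ordinary one, while
    the curve maps this interval into \<open>M\<close>.\<close>
  let ?S = "{-\<epsilon><..<\<epsilon>}"
  have S: "at 0 within ?S = at 0" using \<gamma>(2) by (intro at_within_open) auto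
  have "(\<gamma> has_derivative (\<lambda>h. h *\<^sub>R v)) (at 0 within ?S)"
    using \<gamma>(1) S by (simp add: has_vector_derivative_def)
  moreover have "(f has_derivative D) (at (\<gamma> 0) within \<gamma> ` ?S)"
    using \<gamma>(3) p by (intro has_derivative_subset[OF f[folded p]]) auto
  ultimately have "(f \<circ> \<gamma> has_derivative D \<circ> (\<lambda>h. h *\<^sub>R v)) (at 0)"
    using diff_chain_within[of \<gamma> _ 0 ?S f D] S by simp
  moreover have "D \<circ> (\<lambda>h. h *\<^sub>R v) = (\<lambda>h. h *\<^sub>R D v)"
    using has_derivative_bounded_linear[OF f] by (auto simp: linear_scale bounded_linear.linear)
  ultimately show ?thesis by (simp add: has_vector_derivative_def o_def)
qed

text \<open>\<open>frechet_derivative\<close> within \<open>M\<close> selects one of possibly many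
  derivatives. Each of them computes the velocity of \<open>f\<close> along a curve in
  \<open>M\<close>, so they agree on \<open>v\<close>.\<close>

lemma D_along_eq:
  assumes f: "(f has_derivative D) (at p within M)" and v: "v \<in> tangent_space M p"
  shows "D_along M f p v = D v"
proof -
  obtain \<gamma> \<epsilon> where \<gamma>: "\<epsilon> > 0" "\<gamma> 0 = p" "\<And>t. \<bar>t\<bar> < \<epsilon> \<Longrightarrow> \<gamma> t \<in> M" "(\<gamma> has_vector_derivative v) (at 0)"
    using v by (auto simp: tangent_space_def)
  have "(f has_derivative frechet_derivative f (at p within M)) (at p within M)"
    using f frechet_derivative_works by (auto simp: differentiable_def)
  from has_derivative_within_curve[OF this \<gamma>(2,4,1,3)] has_derivative_within_curve[OF f \<gamma>(2,4,1,3)]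
  show ?thesis unfolding D_along_def by (rule vector_derivative_unique_at)
qed

lemma submanifold_chart:
  fixes M :: "'a::euclidean_space set"
  assumes "submanifold r k M" "1 \<le> r" "p \<in> M"
  obtains U V and \<phi> \<psi> :: "'a \<Rightarrow> 'a" and L where "open U" "open V" "p \<in> U" "homeomorphism U V \<phi> \<psi>"
    "C_on 1 \<phi> U" "C_on 1 \<psi> V" "subspace L" "dim L = k" "\<phi> ` (U \<inter> M) = V \<inter> L"
proof -
  from assms(1,3) have "\<exists>U V (\<phi>::'a \<Rightarrow> 'a) \<psi> L. open U \<and> open V \<and> p \<in> U \<and> homeomorphism U V \<phi> \<psi> \<and>
      C_on r \<phi> U \<and> C_on r \<psi> V \<and> subspace L \<and> dim L = k \<and> \<phi> ` (U \<inter> M) = V \<inter> L"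
    unfolding submanifold_def by (rule bspec)
  then show thesis
    using that C_on_mono[OF _ assms(2)] by blast
qed

text \<open>Velocities of curves in a general set need not be closed under addition. A chart
  identifies them with the image of the slice \<open>L\<close> under the derivative \<open>B\<close>
  of the inverse chart.\<close>

lemma subspace_tangent_space:
  fixes M :: "'a::euclidean_space set"
  assumes M: "submanifold r k M" "1 \<le> r" "p \<in> M"
  shows "subspace (tangent_space M p)"
proof -
  obtain U V and \<phi> \<psi> :: "'a \<Rightarrow> 'a" and L where ch: "open U" "open V" "p \<in> U" "homeomorphism U V \<phi> \<psi>"
    "C_on 1 \<phi> U" "C_on 1 \<psi> V" "subspace L" "dim L = k" "\<phi> ` (U \<inter> M) = V \<inter> L"
    using submanifold_chart[OF M] .
  define A where "A = frechet_derivative \<phi> (at p)"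
  define B where "B = frechet_derivative \<psi> (at (\<phi> p))"
  have \<phi>p: "\<phi> p \<in> V" "\<phi> p \<in> L" "\<psi> (\<phi> p) = p"
    using ch M(3) by (auto simp: homeomorphism_def)
  have A: "(\<phi> has_derivative A) (at p)"
    using ch by (auto simp: A_def intro: C_on_1_has_derivative)
  have B: "(\<psi> has_derivative B) (at (\<phi> p))"
    using ch \<phi>p by (auto simp: B_def intro: C_on_1_has_derivative)
  have "tangent_space M p = B ` L"
  proof (intro equalityI subsetI)
    fix v assume "v \<in> tangent_space M p"
    then obtain \<gamma> \<epsilon> where \<gamma>: "\<epsilon> > 0" "\<gamma> 0 = p" "\<And>t. \<bar>t\<bar> < \<epsilon> \<Longrightarrow> \<gamma> t \<in> M"
      "(\<gamma> has_vector_derivative v) (at 0)"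
      by (auto simp: tangent_space_def)
    have "isCont \<gamma> 0" using \<gamma>(4) has_vector_derivative_continuous by blast
    then have "\<forall>\<^sub>F t in at 0. \<gamma> t \<in> U"
      using ch(1,3) \<gamma>(2) by (auto simp: isCont_def intro: topological_tendstoD)
    moreover have "\<forall>\<^sub>F t in at 0. \<gamma> t \<in> M"
      using \<gamma>(1,3) by (auto simp: eventually_at dist_norm intro!: exI[of _ \<epsilon>])
    ultimately have ev: "\<forall>\<^sub>F t in at 0. \<gamma> t \<in> U \<inter> M" by eventually_elim auto
    then obtain \<delta> where \<delta>: "\<delta> > 0" "\<And>t. t \<noteq> 0 \<Longrightarrow> \<bar>t\<bar> < \<delta> \<Longrightarrow> \<gamma> t \<in> U"
      by (auto simp: eventually_at dist_norm)
    have in_L: "\<phi> (\<gamma> t) \<in> L" if "\<gamma> t \<in> U \<inter> M" for t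
      using that ch(9) by blast
    have d\<phi>: "((\<lambda>t. \<phi> (\<gamma> t)) has_vector_derivative A v) (at 0)"
      using has_derivative_within_curve[OF A \<gamma>(2,4) zero_less_one] by simp
    then have "(\<lambda>t. norm (\<phi> (\<gamma> t) - \<phi> p - t *\<^sub>R A v) / norm t) \<midarrow>0\<rightarrow> 0"
      using \<gamma>(2) by (simp add: has_vector_derivative_def has_derivative_at)
    \<comment> \<open>The remainder is rewritten through difference quotients. These lie in
      \<open>L\<close> for small \<open>t\<close>, and \<open>L\<close> is closed, so their limit
      \<open>A v\<close> lies in \<open>L\<close>.\<close>
    moreover have "\<forall>\<^sub>F t in at 0. norm (\<phi> (\<gamma> t) - \<phi> p - t *\<^sub>R A v) / norm t
        = norm ((1 / t) *\<^sub>R (\<phi> (\<gamma> t) - \<phi> p) - A v)"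
    proof (rule eventually_at_topological[THEN iffD2], intro exI[of _ UNIV] conjI ballI impI)
      fix t :: real assume "t \<noteq> 0"
      then have "(1 / t) *\<^sub>R (\<phi> (\<gamma> t) - \<phi> p) - A v = (1 / t) *\<^sub>R (\<phi> (\<gamma> t) - \<phi> p - t *\<^sub>R A v)"
        by (simp add: scaleR_diff_right)
      then show "norm (\<phi> (\<gamma> t) - \<phi> p - t *\<^sub>R A v) / norm t
          = norm ((1 / t) *\<^sub>R (\<phi> (\<gamma> t) - \<phi> p) - A v)"
        by (simp only: norm_scaleR) (simp add: field_simps)
    qed auto
    ultimately have "((\<lambda>t. norm ((1 / t) *\<^sub>R (\<phi> (\<gamma> t) - \<phi> p) - A v)) \<longlongrightarrow> 0) (at 0)"
      by (rule Lim_transform_eventually)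
    then have "((\<lambda>t. (1 / t) *\<^sub>R (\<phi> (\<gamma> t) - \<phi> p)) \<longlongrightarrow> A v) (at 0)"
      by (simp only: tendsto_norm_zero_iff Lim_null[symmetric])
    moreover have "\<forall>\<^sub>F t in at 0. (1 / t) *\<^sub>R (\<phi> (\<gamma> t) - \<phi> p) \<in> L"
      using ev by eventually_elim (use ch(7) \<phi>p in_L in \<open>auto intro: subspace_scale subspace_diff\<close>)
    ultimately have "A v \<in> L"
      using ch(7) by (intro Lim_in_closed_set[of L]) (auto intro: closed_subspace)
    \<comment> \<open>Near 0 the curve is unchanged by \<open>\<phi>\<close> followed by
      \<open>\<psi>\<close>, so uniqueness of the velocity yields
      \<open>v = B (A v)\<close>.\<close>
    have "((\<lambda>t. \<psi> (\<phi> (\<gamma> t))) has_vector_derivative B (A v)) (at 0)"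
      using has_derivative_within_curve[OF B _ d\<phi> zero_less_one] \<gamma>(2) by simp
    then have "(\<gamma> has_vector_derivative B (A v)) (at 0)"
    proof (rule has_vector_derivative_transform_within_open[of _ _ _ "{-\<delta><..<\<delta>}"])
      fix t assume "t \<in> {-\<delta><..<\<delta>}"
      then have "\<gamma> t \<in> U" using \<delta>(2)[of t] \<gamma>(2) ch(3) by (cases "t = 0") auto
      then show "\<psi> (\<phi> (\<gamma> t)) = \<gamma> t" using ch(4) by (auto simp: homeomorphism_def)
    qed (use \<delta> in auto)
    then have "v = B (A v)" using \<gamma>(4) vector_derivative_unique_at by blast
    then show "v \<in> B ` L" using \<open>A v \<in> L\<close> by blast
  next
    fix v assume "v \<in> B ` L"
    then obtain l where l: "l \<in> L" "v = B l" by auto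
    \<comment> \<open>For the converse, \<open>\<psi>\<close> carries the line through
      \<open>\<phi> p\<close> in direction \<open>l\<close> to a curve in \<open>M\<close>, since
      near 0 the line stays in \<open>V \<inter> L\<close>.\<close>
    define c where "c t = \<phi> p + t *\<^sub>R l" for t
    have c: "(c has_vector_derivative l) (at 0)"
      unfolding c_def by (auto intro!: derivative_eq_intros)
    have "open (c -` V)"
      using ch(2) by (intro open_vimage) (auto simp: c_def intro!: continuous_intros)
    moreover have "0 \<in> c -` V" using \<phi>p by (simp add: c_def)
    ultimately obtain \<epsilon> where \<epsilon>: "\<epsilon> > 0" "ball 0 \<epsilon> \<subseteq> c -` V"
      using open_contains_ball by blast
    have "\<psi> (c t) \<in> M" if "\<bar>t\<bar> < \<epsilon>" for t
    proof -
      have "c t \<in> V" using \<epsilon>(2) that by auto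
      moreover have "c t \<in> L" using l(1) \<phi>p ch(7) by (auto simp: c_def intro: subspace_add subspace_scale)
      ultimately obtain q where "q \<in> U \<inter> M" "c t = \<phi> q" using ch(9) by blast
      then show ?thesis using ch(4) by (auto simp: homeomorphism_def)
    qed
    moreover have "((\<lambda>t. \<psi> (c t)) has_vector_derivative B l) (at 0)"
      using has_derivative_within_curve[OF B _ c zero_less_one] by (simp add: c_def)
    moreover have "\<psi> (c 0) = p" using \<phi>p by (simp add: c_def)
    ultimately show "v \<in> tangent_space M p"
      using \<epsilon>(1) l(2) unfolding tangent_space_def
      by (intro CollectI exI[of _ "\<lambda>t. \<psi> (c t)"] exI[of _ \<epsilon>]) auto
  qed
  moreover have "linear B" using B has_derivative_linear by blast
  ultimately show ?thesis using ch(7) by (simp add: linear_subspace_image)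
qed

lemma tangent_frame:
  fixes M :: "'a::euclidean_space set"
  assumes "subspace (tangent_space M p)"
  shows "tangent_frame M p \<subseteq> tangent_space M p" "pairwise orthogonal (tangent_frame M p)"
    "\<And>e. e \<in> tangent_frame M p \<Longrightarrow> norm e = 1" "span (tangent_frame M p) = tangent_space M p"
    "finite (tangent_frame M p)"
proof -
  let ?P = "\<lambda>E. E \<subseteq> tangent_space M p \<and> pairwise orthogonal E \<and> (\<forall>e\<in>E. norm e = 1) \<and>
         span E = tangent_space M p"
  have "\<exists>E. ?P E" using orthonormal_basis_subspace[OF assms] by metis
  then have "?P (tangent_frame M p)" unfolding tangent_frame_def by (rule someI_ex)
  then show "tangent_frame M p \<subseteq> tangent_space M p" "pairwise orthogonal (tangent_frame M p)"
    "\<And>e. e \<in> tangent_frame M p \<Longrightarrow> norm e = 1" "span (tangent_frame M p) = tangent_space M p"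
    by auto
  then show "finite (tangent_frame M p)" by (auto intro: pairwise_orthogonal_imp_finite)
qed

text \<open>The inverse chart is Lipschitz on a small closed ball, so a neighbourhood in
  \<open>M\<close> lies in a Lipschitz image of a bounded piece of \<open>L\<close>.\<close>

lemma submanifold_locally_finite_hausdorff:
  fixes M :: "'a::euclidean_space set"
  assumes M: "submanifold r k M" "1 \<le> r" "p \<in> M"
  obtains W where "open W" "p \<in> W" "hausdorff_outer k (W \<inter> M) < \<infinity>"
proof -
  obtain U V and \<phi> \<psi> :: "'a \<Rightarrow> 'a" and L where ch: "open U" "open V" "p \<in> U" "homeomorphism U V \<phi> \<psi>"
    "C_on 1 \<phi> U" "C_on 1 \<psi> V" "subspace L" "dim L = k" "\<phi> ` (U \<inter> M) = V \<inter> L"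
    using submanifold_chart[OF M] .
  have "\<phi> p \<in> V" using ch by (auto simp: homeomorphism_def)
  then obtain e where e: "e > 0" "cball (\<phi> p) e \<subseteq> V" using ch(2) open_contains_cball by blast
  let ?D = "\<lambda>x. frechet_derivative \<psi> (at x)"
  \<comment> \<open>Continuity of the derivative is available one direction at a time. Compactness
    bounds each direction, and the sum over the basis controls the operator norm.\<close>
  have "\<exists>c. \<forall>x\<in>cball (\<phi> p) e. norm (?D x b) \<le> c" for b
  proof -
    have "continuous_on (cball (\<phi> p) e) (\<lambda>x. ?D x b)"
      using ch(6) e(2) by (auto simp: C_on_1_iff intro: continuous_on_subset)
    then have "bounded ((\<lambda>x. ?D x b) ` cball (\<phi> p) e)"
      by (intro compact_imp_bounded compact_continuous_image) auto
    then show ?thesis by (auto simp: bounded_iff)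
  qed
  then have "\<forall>b. \<exists>c. \<forall>x\<in>cball (\<phi> p) e. norm (?D x b) \<le> c" by blast
  then obtain c where c: "\<And>b x. x \<in> cball (\<phi> p) e \<Longrightarrow> norm (?D x b) \<le> c b"
    unfolding choice_iff by blast
  \<comment> \<open>The summand 1 makes the constant positive, as the Lipschitz estimate for the
    outer measure demands.\<close>
  define \<Lambda> where "\<Lambda> = 1 + (\<Sum>b\<in>Basis. \<bar>c b\<bar>)"
  have \<Lambda>: "\<Lambda> > 0" unfolding \<Lambda>_def by (intro add_pos_nonneg sum_nonneg) auto
  have "\<Lambda>-lipschitz_on (cball (\<phi> p) e) \<psi>"
  proof (rule bounded_derivative_imp_lipschitz)
    fix x assume x: "x \<in> cball (\<phi> p) e"
    have D: "(\<psi> has_derivative ?D x) (at x)"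
      using ch(6) e(2) x by (auto intro: C_on_1_has_derivative)
    then show "(\<psi> has_derivative ?D x) (at x within cball (\<phi> p) e)"
      by (rule has_derivative_at_withinI)
    have "onorm (?D x) \<le> (\<Sum>b\<in>Basis. norm (?D x b))"
      using D has_derivative_bounded_linear by (intro onorm_componentwise) auto
    also have "\<dots> \<le> (\<Sum>b\<in>Basis. \<bar>c b\<bar>)"
      using c[OF x] by (intro sum_mono) (meson abs_ge_self order_trans)
    finally show "onorm (?D x) \<le> \<Lambda>" by (simp add: \<Lambda>_def)
  qed (use \<Lambda> in auto)
  then have lip: "\<Lambda>-lipschitz_on (cball (\<phi> p) e \<inter> L) \<psi>"
    by (rule lipschitz_on_subset) auto
  define W where "W = U \<inter> \<phi> -` ball (\<phi> p) e"
  have "continuous_on U \<phi>" using ch(4) by (simp add: homeomorphism_def)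
  then have "open W" unfolding W_def using ch(1) by (intro continuous_open_preimage) auto
  moreover have "p \<in> W" using e ch(3) by (simp add: W_def)
  moreover have "W \<inter> M \<subseteq> \<psi> ` (cball (\<phi> p) e \<inter> L)"
  proof
    fix q assume q: "q \<in> W \<inter> M"
    then have "\<phi> q \<in> L" "\<psi> (\<phi> q) = q" "\<phi> q \<in> cball (\<phi> p) e"
      using ch(4,9) by (auto simp: W_def homeomorphism_def)
    then show "q \<in> \<psi> ` (cball (\<phi> p) e \<inter> L)" by (intro image_eqI[of q \<psi> "\<phi> q"]) auto
  qed
  then have "hausdorff_outer k (W \<inter> M) \<le> ennreal (\<Lambda> ^ k) * hausdorff_outer k (cball (\<phi> p) e \<inter> L)"
    by (rule order_trans[OF hausdorff_outer_mono hausdorff_outer_lipschitz[OF lip \<Lambda>]])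
  moreover have "hausdorff_outer k (cball (\<phi> p) e \<inter> L) < \<infinity>"
    using ch(7,8) by (intro hausdorff_outer_bounded_subspace[of L]) (auto intro: bounded_Int)
  then have "ennreal (\<Lambda> ^ k) * hausdorff_outer k (cball (\<phi> p) e \<inter> L) < \<infinity>"
    by (simp add: ennreal_mult_less_top)
  ultimately show thesis by (intro that) (auto intro: le_less_trans)
qed

text \<open>Local finiteness and compactness. This makes bounded measurable functions with compact
  support in \<open>M\<close> integrable, among them the majorant for dominated convergence.\<close>

lemma emeasure_compact_submanifold_finite:
  fixes M :: "'a::euclidean_space set"
  assumes M: "submanifold r k M" "1 \<le> r" and K: "compact K" "K \<subseteq> M" and bM: "M \<in> sets borel"
  shows "emeasure (hausdorff_measure k) K < \<infinity>"
proof -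
  let ?G = "{W. open W \<and> hausdorff_outer k (W \<inter> M) < \<infinity>}"
  have "K \<subseteq> \<Union>?G" using submanifold_locally_finite_hausdorff[OF M] K(2) by blast
  then obtain F where F: "F \<subseteq> ?G" "finite F" "K \<subseteq> \<Union>F"
    by (rule compactE[OF K(1)]) auto
  have meas: "W \<inter> M \<in> sets borel" if "W \<in> F" for W using F that bM by auto
  have "(\<Union>W\<in>F. W \<inter> M) \<in> sets borel"
    using F(2) meas by (intro sets.finite_UN) auto
  then have "emeasure (hausdorff_measure k) K \<le> emeasure (hausdorff_measure k) (\<Union>W\<in>F. W \<inter> M)"
    using F(3) K(2) by (intro emeasure_mono) auto
  also have "\<dots> \<le> (\<Sum>W\<in>F. emeasure (hausdorff_measure k) (W \<inter> M))"
    using F meas by (intro emeasure_subadditive_finite) auto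
  also have "\<dots> \<le> (\<Sum>W\<in>F. hausdorff_outer k (W \<inter> M))"
    using meas by (intro sum_mono emeasure_hausdorff_measure_le)
  also have "\<dots> < \<infinity>" using F by auto
  finally show ?thesis .
qed

section \<open>Radial weights on cones\<close>

text \<open>By homogeneity the integral of \<open>w\<close> dilated by t is t^(-k) times that of
  \<open>w\<close>, hence nonincreasing in t as \<open>w\<close> is nonnegative. Its derivative at t
  = 1 is the integral of \<open>d\<close>; only the sign is kept.\<close>

lemma cone_integral_radial_derivative:
  fixes w d :: "'a::euclidean_space \<Rightarrow> real"
  assumes M: "M \<in> sets borel" and cone: "\<And>t p. t > 0 \<Longrightarrow> t *\<^sub>R p \<in> M \<longleftrightarrow> p \<in> M"
    and fin: "\<And>K. compact K \<Longrightarrow> K \<subseteq> M \<Longrightarrow> emeasure (hausdorff_measure k) K < \<infinity>"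
    and K: "compact K" "K \<subseteq> M" and w0: "\<And>p. p \<in> M - K \<Longrightarrow> w p = 0"
    and nonneg: "\<And>p. p \<in> M \<Longrightarrow> 0 \<le> w p"
    and cont: "continuous_on M w" "continuous_on M d"
    and deriv: "\<And>p. p \<in> M \<Longrightarrow> ((\<lambda>t. w (t *\<^sub>R p)) has_real_derivative d p) (at 1)"
  shows "set_integrable (hausdorff_measure k) M w" "set_integrable (hausdorff_measure k) M d"
    "(LINT p:M|hausdorff_measure k. d p) \<le> 0" "0 \<le> (LINT p:M|hausdorff_measure k. w p)"
proof -
  let ?H = "hausdorff_measure k :: 'a measure"
  \<comment> \<open>Extension by zero gives a Borel function on the whole space, to which the
    scaling formula for integrals applies.\<close>
  define W where "W p = indicator M p *\<^sub>R w p" for p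
  have Wm [measurable]: "W \<in> borel_measurable borel" and dm: "(\<lambda>p. indicator M p *\<^sub>R d p) \<in> borel_measurable borel"
    unfolding W_def using M cont by (auto intro!: borel_measurable_continuous_on_indicator simp del: real_scaleR_def)
  have dm': "(\<lambda>p. indicator M p *\<^sub>R d p) \<in> borel_measurable ?H"
    using dm measurable_cong_sets[OF sets_hausdorff_measure refl] by blast
  have Wnn: "0 \<le> W p" for p using nonneg by (simp add: W_def indicator_def)
  have W0: "W p = 0" if "p \<notin> K" for p using that w0 by (auto simp: W_def indicator_def)
  \<comment> \<open>The complement of \<open>K\<close> is open, so a short piece of the ray through
    \<open>p\<close> avoids \<open>K\<close> and \<open>w\<close> vanishes along it.\<close>
  have d0: "d p = 0" if p: "p \<in> M - K" for p
  proof -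
    have "open ((\<lambda>t::real. t *\<^sub>R p) -` (- K))"
      using K(1) by (intro open_vimage) (auto intro!: continuous_intros simp: compact_imp_closed)
    then have "open ((\<lambda>t. t *\<^sub>R p) -` (- K) \<inter> {0<..})" by auto
    then have "((\<lambda>t. w (t *\<^sub>R p)) has_real_derivative 0) (at 1)"
      using p w0 cone
      by (intro has_field_derivative_transform_within_open[OF DERIV_const[of 0]]) auto
    then show ?thesis using deriv p DERIV_unique by blast
  qed
  obtain B where B: "\<And>p. p \<in> M \<Longrightarrow> \<bar>d p\<bar> \<le> B" "0 \<le> B"
  proof -
    have "bounded (d ` K)"
      using K cont(2) by (meson compact_continuous_image compact_imp_bounded continuous_on_subset)
    then obtain B where "\<And>p. p \<in> K \<Longrightarrow> \<bar>d p\<bar> \<le> B" by (auto simp: bounded_iff)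
    then have "\<bar>d p\<bar> \<le> max B 0" if "p \<in> M" for p
      using d0[of p] that by (cases "p \<in> K") (auto simp: le_max_iff_disj)
    then show thesis using that[of "max B 0"] by simp
  qed
  \<comment> \<open>The hypothesis concerns t = 1 only. Viewing the ray from \<open>s\<close> times
    \<open>p\<close> moves any parameter \<open>s\<close> to 1, at the price of the factor
    1/s.\<close>
  have deriv_at: "((\<lambda>t. w (t *\<^sub>R p)) has_real_derivative d (s *\<^sub>R p) / s) (at s)"
    if "p \<in> M" "s > 0" for p s
  proof -
    have "((\<lambda>t. w (t *\<^sub>R s *\<^sub>R p)) has_real_derivative d (s *\<^sub>R p)) (at (s / s))"
      using deriv[of "s *\<^sub>R p"] cone that by simp
    then have "((\<lambda>t. w ((t / s) *\<^sub>R s *\<^sub>R p)) has_real_derivative d (s *\<^sub>R p) * (1 / s)) (at s)"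
      using that by (intro DERIV_chain2[where g="\<lambda>t. t / s"]) (auto intro!: derivative_eq_intros)
    then show ?thesis using that by simp
  qed
  \<comment> \<open>One compact set outside which all difference quotients vanish: if the dilate of
    \<open>p\<close> by \<open>1 + a n\<close> lies in \<open>K\<close>, then \<open>p\<close> is a
    point of \<open>K\<close> scaled by \<open>1 / (1 + a n)\<close>, which lies between 1/2 and
    1.\<close>
  define K' where "K' = (\<lambda>(s, x). s *\<^sub>R x) ` ({1/2..1::real} \<times> K)"
  have "compact K'" unfolding K'_def using K
    by (intro compact_continuous_image compact_Times) (auto intro!: continuous_intros simp: case_prod_unfold)
  moreover have "K' \<subseteq> M" using K(2) cone by (auto simp: K'_def)
  ultimately have K'fin: "emeasure ?H K' < \<infinity>" and K'm: "K' \<in> sets ?H"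
    using fin by (auto simp: compact_imp_closed)
  have KK': "K \<subseteq> K'" unfolding K'_def by (force intro: image_eqI[of _ _ "(1, x)" for x])
  have "bounded (w ` K)"
    using K cont(1) by (meson compact_continuous_image compact_imp_bounded continuous_on_subset)
  then obtain B' where "\<And>p. p \<in> K \<Longrightarrow> \<bar>w p\<bar> \<le> B'" by (auto simp: bounded_iff)
  then have Wint: "integrable ?H W"
    using fin[OF K] K W0
    by (intro integrableI_bounded_set[of K _ _ B']) (auto simp: W_def compact_imp_closed subset_iff)
  then show "set_integrable ?H M w" by (simp add: set_integrable_def W_def[abs_def])
  show "0 \<le> (LINT p:M|?H. w p)"
    using Wnn by (simp add: set_lebesgue_integral_def W_def[symmetric] del: real_scaleR_def)
  define a where "a n = inverse (real (Suc n))" for n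
  have a: "a n > 0" "a n \<le> 1" for n by (auto simp: a_def inverse_le_1_iff)
  have a0: "a \<longlonglongrightarrow> 0" unfolding a_def by (rule LIMSEQ_inverse_real_of_nat)
  define s where "s n p = (W ((1 + a n) *\<^sub>R p) - W p) / a n" for n p
  have sm: "s n \<in> borel_measurable ?H" for n unfolding s_def by measurable
  have lim: "(\<lambda>n. s n p) \<longlonglongrightarrow> indicator M p *\<^sub>R d p" for p
  proof (cases "p \<in> M")
    case True
    have "(\<lambda>h. (w ((1 + h) *\<^sub>R p) - w (1 *\<^sub>R p)) / h) \<midarrow>0\<rightarrow> d p"
      using DERIV_D[OF deriv[OF True]] by simp
    moreover have "filterlim a (at 0) sequentially"
      using a0 a(1) by (auto simp: filterlim_at intro!: always_eventually less_imp_neq[symmetric])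
    ultimately have "(\<lambda>n. (w ((1 + a n) *\<^sub>R p) - w (1 *\<^sub>R p)) / a n) \<longlonglongrightarrow> d p"
      by (rule filterlim_compose)
    moreover have "(1 + a n) *\<^sub>R p \<in> M" for n using cone[of "1 + a n" p] a(1)[of n] True by simp
    ultimately show ?thesis using True by (simp add: s_def W_def)
  next
    case False
    then have "(1 + a n) *\<^sub>R p \<notin> M" for n using cone[of "1 + a n" p] a(1)[of n] by simp
    then show ?thesis using False by (simp add: s_def W_def)
  qed
  have bound: "norm (s n p) \<le> B * indicator K' p" for n p
  proof (cases "p \<in> K'")
    case True
    then have p: "p \<in> M" using \<open>K' \<subseteq> M\<close> by auto
    \<comment> \<open>The mean value theorem along the ray expresses the quotient as
      \<open>d\<close> at a farther point divided by \<open>z\<close>. As \<open>z > 1\<close>, the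
      bound \<open>B\<close> for \<open>d\<close> suffices.\<close>
    have "\<exists>z. 1 < z \<and> z < 1 + a n \<and> w ((1 + a n) *\<^sub>R p) - w (1 *\<^sub>R p) = (1 + a n - 1) * (d (z *\<^sub>R p) / z)"
      using a(1)[of n] deriv_at[OF p] by (intro MVT2) auto
    then obtain z where z: "1 < z" "w ((1 + a n) *\<^sub>R p) - w p = a n * (d (z *\<^sub>R p) / z)" by auto
    have "(1 + a n) *\<^sub>R p \<in> M" using cone[of "1 + a n" p] a(1)[of n] p by simp
    then have "s n p = d (z *\<^sub>R p) / z"
      using z(2) p a(1)[of n] by (simp add: s_def W_def)
    moreover have "\<bar>d (z *\<^sub>R p)\<bar> \<le> B" using B(1) cone[of z p] z(1) p by simp
    moreover have "\<bar>d (z *\<^sub>R p)\<bar> / z \<le> \<bar>d (z *\<^sub>R p)\<bar>"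
      using z(1) by (simp add: divide_le_eq mult_le_cancel_left1)
    ultimately show ?thesis using True z(1) by simp
  next
    case False
    have "(1 + a n) *\<^sub>R p \<notin> K"
    proof
      assume "(1 + a n) *\<^sub>R p \<in> K"
      then have "(1 / (1 + a n), (1 + a n) *\<^sub>R p) \<in> {1/2..1} \<times> K"
        using a[of n] by (auto simp: field_simps)
      then have "(1 / (1 + a n)) *\<^sub>R (1 + a n) *\<^sub>R p \<in> K'" unfolding K'_def by force
      moreover have "(1 / (1 + a n)) *\<^sub>R (1 + a n) *\<^sub>R p = p" using a(1)[of n] by simp
      ultimately show False using False by simp
    qed
    then show ?thesis using False KK' W0 by (auto simp: s_def)
  qed
  have Bint: "integrable ?H (\<lambda>p. B * indicator K' p)" using K'fin K'm by simp
  have s_le: "integral\<^sup>L ?H (s n) \<le> 0" for n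
  proof -
    have "integrable ?H (\<lambda>p. W ((1 + a n) *\<^sub>R p))"
    proof -
      \<comment> \<open>The quotient is measurable and dominated, hence integrable; integrability of
        the dilated function is recovered from it.\<close>
      have "integrable ?H (\<lambda>p. a n * s n p + W p)"
        using integrable_dominated_convergence2[OF dm' sm Bint AE_I2[OF lim] AE_I2[OF bound]] Wint by auto
      then show ?thesis using a(1)[of n] by (simp add: s_def less_imp_neq[symmetric])
    qed
    then have "integral\<^sup>L ?H (s n) = ((LINT p|?H. W ((1 + a n) *\<^sub>R p)) - (LINT p|?H. W p)) / a n"
      using Wint by (simp add: s_def[abs_def])
    \<comment> \<open>Homogeneity leaves the factor (1 + a n)^(-k) - 1, which is at most 0.\<close>
    also have "\<dots> = ((1 / (1 + a n)) ^ k - 1) * (LINT p|?H. W p) / a n"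
      using a(1)[of n] by (subst integral_hausdorff_measure_scaleR) (auto simp: algebra_simps)
    also have "\<dots> \<le> 0"
      using a(1)[of n] Wnn
      by (intro divide_nonpos_pos mult_nonpos_nonneg integral_nonneg) (auto simp: power_le_one)
    finally show ?thesis .
  qed
  have "integrable ?H (\<lambda>p. indicator M p *\<^sub>R d p)" and
    conv: "(\<lambda>n. integral\<^sup>L ?H (s n)) \<longlonglongrightarrow> (LINT p|?H. indicator M p *\<^sub>R d p)"
    by (rule integrable_dominated_convergence[OF dm' sm Bint AE_I2[OF lim] AE_I2[OF bound]],
      rule integral_dominated_convergence[OF dm' sm Bint AE_I2[OF lim] AE_I2[OF bound]])
  then show "set_integrable ?H M d" by (simp add: set_integrable_def)
  show "(LINT p:M|?H. d p) \<le> 0"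
    unfolding set_lebesgue_integral_def using s_le by (intro LIMSEQ_le_const2[OF conv]) auto
qed

section \<open>Derivatives of powers of the norm, and rescaled normal fields\<close>

lemma has_derivative_norm_powr:
  fixes p :: "'a::euclidean_space"
  assumes "p \<noteq> 0"
  shows "((\<lambda>x. norm x powr \<alpha>) has_derivative (\<lambda>v. \<alpha> * norm p powr (\<alpha> - 2) * (p \<bullet> v))) (at p)"
proof -
  have "((\<lambda>x. norm x powr \<alpha>) has_derivative
      (\<lambda>v. norm p powr \<alpha> * (0 * ln (norm p) + v \<bullet> sgn p * \<alpha> / norm p))) (at p)"
    using assms by (intro has_derivative_powr has_derivative_norm has_derivative_const) auto
  moreover have "norm p powr \<alpha> * (0 * ln (norm p) + v \<bullet> sgn p * \<alpha> / norm p)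
      = \<alpha> * norm p powr (\<alpha> - 2) * (p \<bullet> v)" for v
    using assms by (simp add: powr_diff sgn_div_norm inner_commute field_simps power2_eq_square)
  ultimately show ?thesis by simp
qed

lemma frechet_derivative_norm_powr:
  fixes p :: "'a::euclidean_space"
  assumes "p \<noteq> 0"
  shows "frechet_derivative (\<lambda>x. norm x powr \<alpha>) (at p) = (\<lambda>v. \<alpha> * norm p powr (\<alpha> - 2) * (p \<bullet> v))"
  by (rule frechet_derivative_at[OF has_derivative_norm_powr[OF assms], symmetric])

lemma gradient_norm_powr:
  fixes p :: "'a::euclidean_space"
  assumes "p \<noteq> 0"
  shows "gradient (\<lambda>x. norm x powr \<alpha>) p = (\<alpha> * norm p powr (\<alpha> - 2)) *\<^sub>R p"
  unfolding gradient_def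
proof (rule the_equality)
  show *: "GDERIV (\<lambda>x. norm x powr \<alpha>) p :> (\<alpha> * norm p powr (\<alpha> - 2)) *\<^sub>R p"
    using has_derivative_norm_powr[OF assms, of \<alpha>] by (simp add: gderiv_def inner_commute mult_ac)
  show "D = (\<alpha> * norm p powr (\<alpha> - 2)) *\<^sub>R p" if "GDERIV (\<lambda>x. norm x powr \<alpha>) p :> D" for D
    using has_derivative_unique[OF that[unfolded gderiv_def] *[unfolded gderiv_def]]
    by (metis vector_eq_ldot inner_commute)
qed

lemma hessian_norm_powr:
  fixes p :: "'a::euclidean_space"
  assumes "p \<noteq> 0"
  shows "hessian (\<lambda>x. norm x powr \<alpha>) p v w =
    \<alpha> * ((\<alpha> - 2) * norm p powr (\<alpha> - 4) * (p \<bullet> v) * (p \<bullet> w) + norm p powr (\<alpha> - 2) * (v \<bullet> w))"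
proof -
  have "((\<lambda>q. \<alpha> * norm q powr (\<alpha> - 2) * (q \<bullet> v)) has_derivative
      (\<lambda>w. \<alpha> * ((\<alpha> - 2) * norm p powr (\<alpha> - 4) * (p \<bullet> v) * (p \<bullet> w) + norm p powr (\<alpha> - 2) * (v \<bullet> w)))) (at p)"
    by (rule has_derivative_eq_rhs, rule has_derivative_mult, rule has_derivative_mult_right,
        rule has_derivative_norm_powr[OF assms], rule has_derivative_inner_left, rule has_derivative_ident)
      (simp add: fun_eq_iff algebra_simps inner_commute)
  \<comment> \<open>The first derivative has its formula only off the origin. This set is open, so
    the formula may be differentiated at \<open>p\<close>.\<close>
  then have "((\<lambda>q. frechet_derivative (\<lambda>x. norm x powr \<alpha>) (at q) v) has_derivative
      (\<lambda>w. \<alpha> * ((\<alpha> - 2) * norm p powr (\<alpha> - 4) * (p \<bullet> v) * (p \<bullet> w) + norm p powr (\<alpha> - 2) * (v \<bullet> w)))) (at p)"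
    using assms
    by (elim has_derivative_transform_within_open[of _ _ _ _ "- {0}"])
      (auto simp: frechet_derivative_norm_powr)
  then show ?thesis unfolding hessian_def by (simp add: frechet_derivative_at[symmetric])
qed

lemma norm_powr_mult_inner_self:
  fixes p :: "'a::euclidean_space"
  assumes "p \<noteq> 0"
  shows "norm p powr (a - 2) * (p \<bullet> p) = norm p powr a"
  using assms by (simp add: powr_diff powr_numeral flip: power2_norm_eq_inner)

text \<open>With \<open>x\<close> the position vector, this collapses the cross terms over a frame
  to the derivative in the radial direction.\<close>

lemma orthonormal_expansion_linear:
  fixes D :: "'a::euclidean_space \<Rightarrow> 'b::euclidean_space"
  assumes E: "finite E" "pairwise orthogonal E" "\<And>e. e \<in> E \<Longrightarrow> norm e = 1" "x \<in> span E"
    and D: "linear D"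
  shows "(\<Sum>e\<in>E. (x \<bullet> e) *\<^sub>R D e) = D x"
proof -
  have "D x = D (\<Sum>e\<in>E. (x \<bullet> e) *\<^sub>R e)"
    using orthonormal_basis_expand[of E x] E by simp
  also have "\<dots> = (\<Sum>e\<in>E. (x \<bullet> e) *\<^sub>R D e)"
    using D by (simp add: linear_sum linear_scale)
  finally show ?thesis by simp
qed

lemma norm_scaled_add_sq:
  fixes u x :: "'a::real_inner"
  shows "(norm (a *\<^sub>R u + b *\<^sub>R x))\<^sup>2 = a\<^sup>2 * (norm u)\<^sup>2 + 2 * (a * b) * (u \<bullet> x) + b\<^sup>2 * (x \<bullet> x)"
  unfolding power2_norm_eq_inner
  by (simp add: inner_add_left inner_add_right inner_commute power2_eq_square algebra_simps)

text \<open>The product rule adds to the scaled derivative a multiple of \<open>X p\<close> with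
  coefficient proportional to \<open>p \<bullet> e\<close>. As \<open>X p\<close> is normal, the
  projection drops out of the cross term, and as \<open>p\<close> is tangent, summing over the frame
  gives \<open>D p\<close> and \<open>p \<bullet> p\<close>.\<close>

lemma sum_normal_derivative_norm_powr_scaled:
  fixes X :: "'a::euclidean_space \<Rightarrow> 'a" and \<beta> :: real
  assumes T: "subspace (tangent_space M p)" and p: "p \<in> tangent_space M p" "p \<noteq> 0"
    and X: "(X has_derivative D) (at p within M)" and N: "X p \<in> normal_space M p"
  defines "Y \<equiv> \<lambda>q. norm q powr \<beta> *\<^sub>R X q"
  shows "(\<Sum>e\<in>tangent_frame M p. (norm (normal_proj M p (D_along M Y p e)))\<^sup>2) =
     norm p powr (2 * \<beta>) * (\<Sum>e\<in>tangent_frame M p. (norm (normal_proj M p (D_along M X p e)))\<^sup>2)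
     + 2 * \<beta> * norm p powr (2 * \<beta> - 2) * (X p \<bullet> D p)
     + \<beta>\<^sup>2 * norm p powr (2 * \<beta> - 2) * (X p \<bullet> X p)"
proof -
  let ?E = "tangent_frame M p"
  note E = tangent_frame[OF T]
  note S = subspace_normal_space[of M p]
  define r where "r = norm p"
  have r: "r > 0" using p(2) by (simp add: r_def)
  have lin: "linear D" using X has_derivative_linear by blast
  have Y: "(Y has_derivative (\<lambda>v. norm p powr \<beta> *\<^sub>R D v + (\<beta> * norm p powr (\<beta> - 2) * (p \<bullet> v)) *\<^sub>R X p))
      (at p within M)"
    unfolding Y_def
    by (rule has_derivative_scaleR[OF has_derivative_at_withinI[OF has_derivative_norm_powr[OF p(2)]] X])
  have "(norm (normal_proj M p (D_along M Y p e)))\<^sup>2 =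
      r powr (2 * \<beta>) * (norm (normal_proj M p (D_along M X p e)))\<^sup>2
      + 2 * \<beta> * r powr (2 * \<beta> - 2) * (X p \<bullet> ((p \<bullet> e) *\<^sub>R D e))
      + \<beta>\<^sup>2 * r powr (2 * \<beta> - 4) * (X p \<bullet> X p) * (p \<bullet> ((p \<bullet> e) *\<^sub>R e))" if e: "e \<in> ?E" for e
  proof -
    have eT: "e \<in> tangent_space M p" using e E(1) by auto
    let ?u = "normal_proj M p (D e)"
    have "normal_proj M p (D_along M Y p e) = r powr \<beta> *\<^sub>R ?u + (\<beta> * r powr (\<beta> - 2) * (p \<bullet> e)) *\<^sub>R X p"
      unfolding D_along_eq[OF Y eT] normal_proj_def r_def using orth_proj_scaled_add[OF S N] by blast
    then have "(norm (normal_proj M p (D_along M Y p e)))\<^sup>2 =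
       (r powr \<beta>)\<^sup>2 * (norm ?u)\<^sup>2 + 2 * (r powr \<beta> * (\<beta> * r powr (\<beta> - 2) * (p \<bullet> e))) * (?u \<bullet> X p)
       + (\<beta> * r powr (\<beta> - 2) * (p \<bullet> e))\<^sup>2 * (X p \<bullet> X p)"
      by (simp only: norm_scaled_add_sq)
    also have "?u \<bullet> X p = X p \<bullet> D e"
      unfolding normal_proj_def using inner_orth_proj[OF S N] by (simp add: inner_commute)
    also have "(r powr \<beta>)\<^sup>2 = r powr (2 * \<beta>)"
      using r by (simp add: power2_eq_square flip: powr_add)
    also have "r powr \<beta> * (\<beta> * r powr (\<beta> - 2) * (p \<bullet> e)) = \<beta> * r powr (2 * \<beta> - 2) * (p \<bullet> e)"
      using r by (simp add: powr_add[symmetric] mult.left_commute[of "r powr \<beta>"] mult.assoc[symmetric])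
    also have "(\<beta> * r powr (\<beta> - 2) * (p \<bullet> e))\<^sup>2 = \<beta>\<^sup>2 * r powr (2 * \<beta> - 4) * (p \<bullet> e)\<^sup>2"
      using r by (simp add: power_mult_distrib power2_eq_square flip: powr_add)
    finally show ?thesis
      using D_along_eq[OF X eT] by (simp add: power2_eq_square[of "p \<bullet> e"] mult_ac)
  qed
  then have "(\<Sum>e\<in>?E. (norm (normal_proj M p (D_along M Y p e)))\<^sup>2) =
     r powr (2 * \<beta>) * (\<Sum>e\<in>?E. (norm (normal_proj M p (D_along M X p e)))\<^sup>2)
     + 2 * \<beta> * r powr (2 * \<beta> - 2) * (X p \<bullet> (\<Sum>e\<in>?E. (p \<bullet> e) *\<^sub>R D e))
     + \<beta>\<^sup>2 * r powr (2 * \<beta> - 4) * (X p \<bullet> X p) * (p \<bullet> (\<Sum>e\<in>?E. (p \<bullet> e) *\<^sub>R e))"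
    by (simp add: sum.distrib sum_distrib_left inner_sum_right)
  also have "(\<Sum>e\<in>?E. (p \<bullet> e) *\<^sub>R D e) = D p"
    using orthonormal_expansion_linear[OF E(5,2,3) _ lin] E(4) p(1) by simp
  also have "(\<Sum>e\<in>?E. (p \<bullet> e) *\<^sub>R e) = p"
    using orthonormal_basis_expand[OF E(2,3) _ E(5)] E(4) p(1) by simp
  also have "\<beta>\<^sup>2 * r powr (2 * \<beta> - 4) * (X p \<bullet> X p) * (p \<bullet> p) = \<beta>\<^sup>2 * r powr (2 * \<beta> - 2) * (X p \<bullet> X p)"
    using norm_powr_mult_inner_self[OF p(2), of "2 * \<beta> - 2"] by (simp add: r_def mult_ac)
  finally show ?thesis by (simp only: r_def)
qed

section \<open>Fields of class C^1 along a submanifold\<close>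

lemma C_on_1_norm_powr_scaleR:
  fixes g :: "'a::euclidean_space \<Rightarrow> 'b::real_normed_vector"
  assumes g: "C_on 1 g U" and U: "0 \<notin> U"
  shows "C_on 1 (\<lambda>x. norm x powr \<beta> *\<^sub>R g x) U"
proof -
  let ?D = "\<lambda>x v. norm x powr \<beta> *\<^sub>R frechet_derivative g (at x) v
      + (\<beta> * norm x powr (\<beta> - 2) * (x \<bullet> v)) *\<^sub>R g x"
  have D: "((\<lambda>x. norm x powr \<beta> *\<^sub>R g x) has_derivative ?D x) (at x)" if "x \<in> U" for x
  proof -
    have "x \<noteq> 0" using that U by auto
    from has_derivative_scaleR[OF has_derivative_norm_powr[OF this] C_on_1_has_derivative[OF g that]]
    show ?thesis .
  qed
  have "continuous_on U g"
    using C_on_1_has_derivative[OF g] by (meson has_derivative_continuous continuous_at_imp_continuous_on)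
  then have "continuous_on U (\<lambda>x. ?D x v)" for v
    using g U by (auto simp: C_on_1_iff intro!: continuous_intros)
  moreover have "?D x = frechet_derivative (\<lambda>x. norm x powr \<beta> *\<^sub>R g x) (at x)" if "x \<in> U" for x
    using D[OF that] by (rule frechet_derivative_at)
  ultimately have "continuous_on U (\<lambda>x. frechet_derivative (\<lambda>x. norm x powr \<beta> *\<^sub>R g x) (at x) v)" for v
    by (metis (no_types, lifting) continuous_on_cong)
  then show ?thesis
    using D by (auto simp: C_on_1_iff differentiable_def)
qed

lemma C_along_norm_powr_scaleR:
  fixes X :: "'a::euclidean_space \<Rightarrow> 'b::real_normed_vector"
  assumes X: "C_along 1 X M" and M: "0 \<notin> M"
  shows "C_along 1 (\<lambda>x. norm x powr \<beta> *\<^sub>R X x) M"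
  unfolding C_along_def
proof
  fix p assume p: "p \<in> M"
  then obtain U g where U: "open U" "p \<in> U" "C_on 1 g U" "\<forall>q\<in>U \<inter> M. g q = X q"
    using X unfolding C_along_def by blast
  \<comment> \<open>The extension may be defined at the origin, where the weight can fail to be
    differentiable; the origin is cut out, which loses no point of \<open>M\<close>.\<close>
  have "C_on 1 g (U - {0})" using U(3) by (auto simp: C_on_1_iff intro: continuous_on_subset)
  then have "C_on 1 (\<lambda>x. norm x powr \<beta> *\<^sub>R g x) (U - {0})" by (rule C_on_1_norm_powr_scaleR) auto
  moreover have "open (U - {0})" "p \<in> U - {0}" using U p M by auto
  ultimately show "\<exists>U g. open U \<and> p \<in> U \<and> C_on 1 g U \<and> (\<forall>q\<in>U \<inter> M. g q = norm q powr \<beta> *\<^sub>R X q)"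
    using U(4) by (intro exI[of _ "U - {0}"] exI[of _ "\<lambda>x. norm x powr \<beta> *\<^sub>R g x"]) auto
qed

text \<open>One extension gives the derivative at all nearby points of \<open>M\<close> at once, as
  continuity in the base point requires.\<close>

lemma C_along_1_extension:
  fixes X :: "'a::euclidean_space \<Rightarrow> 'b::real_normed_vector"
  assumes X: "C_along 1 X M" and p: "p \<in> M"
  obtains U g where "open U" "p \<in> U" "C_on 1 g U" "\<And>q. q \<in> U \<inter> M \<Longrightarrow> g q = X q"
    "\<And>q. q \<in> U \<inter> M \<Longrightarrow> (X has_derivative frechet_derivative g (at q)) (at q within M)"
proof -
  obtain U g where U: "open U" "p \<in> U" "C_on 1 g U" "\<forall>q\<in>U \<inter> M. g q = X q"
    using assms unfolding C_along_def by blast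
  have "(X has_derivative frechet_derivative g (at q)) (at q within M)" if q: "q \<in> U \<inter> M" for q
  proof -
    obtain e where e: "e > 0" "ball q e \<subseteq> U" using U(1) q open_contains_ball by blast
    have "(g has_derivative frechet_derivative g (at q)) (at q within M)"
      using q U(3) by (auto intro: has_derivative_at_withinI C_on_1_has_derivative)
    then show ?thesis
    proof (rule has_derivative_transform_within[OF _ e(1)])
      fix x assume "x \<in> M" "dist x q < e"
      then have "x \<in> U \<inter> M" using e(2) by (auto simp: dist_commute subset_iff)
      then show "g x = X x" using U(4) by blast
    qed (use q in auto)
  qed
  with U that show thesis by blast
qed

lemma C_along_1_has_derivative:
  fixes X :: "'a::euclidean_space \<Rightarrow> 'b::real_normed_vector"
  assumes "C_along 1 X M" "p \<in> M"
  shows "(X has_derivative D_along M X p) (at p within M)"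
proof -
  obtain U g where "p \<in> U" "\<And>q. q \<in> U \<inter> M \<Longrightarrow> (X has_derivative frechet_derivative g (at q)) (at q within M)"
    using C_along_1_extension[OF assms] by metis
  then have "X differentiable (at p within M)" using assms(2) by (auto simp: differentiable_def)
  then show ?thesis unfolding D_along_def[abs_def] by (simp add: frechet_derivative_works)
qed

lemma C_along_1_continuous_on:
  fixes X :: "'a::euclidean_space \<Rightarrow> 'b::real_normed_vector"
  assumes "C_along 1 X M"
  shows "continuous_on M X"
  unfolding continuous_on_eq_continuous_within
  using C_along_1_has_derivative[OF assms] has_derivative_continuous by blast

text \<open>The derivative selected within \<open>M\<close> is uncontrolled in normal directions,
  but the radial direction is tangent, so there it agrees with the derivative of a local
  extension.\<close>

lemma continuous_on_radial_D_along:
  fixes X :: "'a::euclidean_space \<Rightarrow> 'b::real_normed_vector"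
  assumes X: "C_along 1 X M" and rad: "\<And>p. p \<in> M \<Longrightarrow> p \<in> tangent_space M p"
  shows "continuous_on M (\<lambda>p. D_along M X p p)"
proof (rule continuous_on_locally_eq)
  fix p assume "p \<in> M"
  then obtain U g where U: "open U" "p \<in> U" "C_on 1 g U"
    "\<And>q. q \<in> U \<inter> M \<Longrightarrow> (X has_derivative frechet_derivative g (at q)) (at q within M)"
    using C_along_1_extension[OF X] by metis
  \<comment> \<open>The direction moves with \<open>q\<close>, while continuity is known for fixed
    directions; expansion in the standard basis separates the two.\<close>
  let ?h = "\<lambda>q. \<Sum>b\<in>Basis. (q \<bullet> b) *\<^sub>R frechet_derivative g (at q) b"
  have "continuous_on (U \<inter> M) ?h"
    using U(3) by (auto simp: C_on_1_iff intro!: continuous_intros intro: continuous_on_subset)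
  moreover have "?h q = D_along M X q q" if q: "q \<in> U \<inter> M" for q
  proof -
    have "linear (frechet_derivative g (at q))"
      using U(4)[OF q] has_derivative_linear by blast
    then have "frechet_derivative g (at q) q = ?h q"
      by (subst (2) euclidean_representation[of q, symmetric]) (simp only: linear_sum linear_scale)
    then show ?thesis using D_along_eq[OF U(4)[OF q] rad] q by simp
  qed
  ultimately show "\<exists>U h. open U \<and> p \<in> U \<and> continuous_on (U \<inter> M) h \<and> (\<forall>q\<in>U \<inter> M. h q = D_along M X q q)"
    using U(1,2) by blast
qed

text \<open>If \<open>Q\<close> is not integrable then neither is \<open>P\<close>, and both integrals take the junk value \<open>0\<close>.\<close>

lemma set_integral_add_nonneg_le:
  fixes P Q h :: "'a \<Rightarrow> real"
  assumes M: "M \<in> sets N" and h: "set_integrable N M h" "0 \<le> (LINT p:M|N. h p)"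
    and eq: "\<And>p. p \<in> M \<Longrightarrow> P p = Q p + h p"
  shows "(LINT p:M|N. Q p) \<le> (LINT p:M|N. P p)"
proof (cases "set_integrable N M Q")
  case True
  have "(LINT p:M|N. P p) = (LINT p:M|N. Q p + h p)"
    using eq by (intro set_lebesgue_integral_cong M) auto
  also have "\<dots> = (LINT p:M|N. Q p) + (LINT p:M|N. h p)"
    using True h(1) by (rule set_integral_add)
  finally show ?thesis using h(2) by simp
next
  case False
  have "\<not> set_integrable N M P"
  proof
    assume "set_integrable N M P"
    then have "set_integrable N M (\<lambda>p. P p - h p)" using h(1) by (rule set_integral_diff)
    moreover have "set_integrable N M (\<lambda>p. P p - h p) \<longleftrightarrow> set_integrable N M Q"
      using eq M by (intro set_integrable_cong) auto
    ultimately show False using False by simp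
  qed
  then show ?thesis
    using False by (simp add: set_integrable_def set_lebesgue_integral_def not_integrable_integral_eq)
qed

text \<open>Dilation invariance enters twice: it makes the position vector tangent, and it allows
  integrals over \<open>M\<close> to be rescaled.\<close>

lemma f_stable_norm_powr_cone:
  fixes M :: "'a::euclidean_space set"
  assumes \<alpha>: "\<alpha> \<ge> 0" and bM: "M \<in> sets borel" and M0: "0 \<notin> M"
    and cone: "\<And>t p. t > 0 \<Longrightarrow> t *\<^sub>R p \<in> M \<longleftrightarrow> p \<in> M"
    and stable: "area_stable k M"
  shows "f_stable k (\<lambda>x. norm x powr \<alpha>) M"
proof -
  let ?f = "\<lambda>x::'a. norm x powr \<alpha>"
  let ?H = "hausdorff_measure k :: 'a measure"
  have sub: "submanifold 2 k M" using stable by (simp add: f_stable_def f_stationary_def)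
  have one_two: "(1 :: enat) \<le> 2" by (simp add: one_le_numeral)
  have T: "subspace (tangent_space M p)" if "p \<in> M" for p
    using subspace_tangent_space[OF sub one_two that] .
  \<comment> \<open>The parameter is shifted so that the ray passes \<open>p\<close> at 0; for
    \<open>\<bar>t\<bar> < 1\<close> the dilation factor stays positive.\<close>
  have radial_curve: "((\<lambda>t. (t + 1) *\<^sub>R p) has_vector_derivative p) (at 0)" for p :: 'a
    by (auto intro!: derivative_eq_intros)
  have radial_in: "(t + 1) *\<^sub>R p \<in> M" if "p \<in> M" "\<bar>t\<bar> < 1" for p t
    using cone[of "t + 1" p] that by auto
  have rad: "p \<in> tangent_space M p" if "p \<in> M" for p
    unfolding tangent_space_def using radial_curve[of p] radial_in[OF that]
    by (intro CollectI exI[of _ "\<lambda>t. (t + 1) *\<^sub>R p"] exI[of _ 1]) auto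
  \<comment> \<open>For the weight 1 the stationarity equation therefore says that the mean
    curvature vanishes.\<close>
  have grad1: "gradient (\<lambda>_::'a. 1) p = 0" for p
    unfolding gradient_def
  proof (rule the_equality)
    show "GDERIV (\<lambda>_. 1) p :> 0" by (rule GDERIV_const)
    show "D = 0" if "GDERIV (\<lambda>_. 1) p :> D" for D
      using has_derivative_unique[OF that[unfolded gderiv_def] has_derivative_const]
      by (metis inner_eq_zero_iff)
  qed
  have H0: "mean_curvature M p = 0" if "p \<in> M" for p
  proof -
    have "normal_proj M p 0 = 0" by (rule normal_proj_tangent[OF subspace_0[OF T[OF that]]])
    moreover have "mean_curvature M p = normal_proj M p (gradient (\<lambda>_. 1) p)"
      using stable that M0 by (auto simp: f_stable_def f_stationary_def)
    ultimately show ?thesis by (simp add: grad1)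
  qed
  have "f_stationary k ?f M"
    unfolding f_stationary_def
  proof (intro conjI ballI)
    fix p assume "p \<in> M - {0}"
    then have p: "p \<in> M" "p \<noteq> 0" by auto
    \<comment> \<open>The gradient of a radial weight is a multiple of the tangent vector
      \<open>p\<close>, so both sides of the weighted equation vanish.\<close>
    have "normal_proj M p ((\<alpha> * norm p powr (\<alpha> - 2)) *\<^sub>R p) = 0"
      using T rad p(1) by (intro normal_proj_tangent subspace_scale)
    then show "?f p *\<^sub>R mean_curvature M p = normal_proj M p (gradient ?f p)"
      using p by (simp add: H0 gradient_norm_powr)
  qed (rule sub)
  moreover have "(LINT p:M|?H. ?f p * ((\<Sum>e\<in>tangent_frame M p. \<Sum>e'\<in>tangent_frame M p.
            (second_ff M p e e' \<bullet> X p)\<^sup>2) + (mean_curvature M p \<bullet> X p)\<^sup>2))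
        \<le> (LINT p:M|?H. ?f p * (\<Sum>e\<in>tangent_frame M p. (norm (normal_proj M p (D_along M X p e)))\<^sup>2)
            + hessian ?f p (X p) (X p))"
    if "normal_test_field M X" for X
  proof -
    from that obtain K where C1: "C_along 1 X M" and N: "\<And>p. p \<in> M \<Longrightarrow> X p \<in> normal_space M p"
      and K: "compact K" "K \<subseteq> M" "\<And>p. p \<in> M - K \<Longrightarrow> X p = 0"
      by (auto simp: normal_test_field_def)
    define Y where "Y q = norm q powr (\<alpha> / 2) *\<^sub>R X q" for q
    define w where "w p = norm p powr (\<alpha> - 2) * (X p \<bullet> X p)" for p
    \<comment> \<open>Product rule for \<open>w\<close> in the direction \<open>p\<close>:
      differentiating the power of the norm multiplies it by \<open>\<alpha> - 2\<close>.\<close>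
    define d where "d p = (\<alpha> - 2) * w p + 2 * norm p powr (\<alpha> - 2) * (X p \<bullet> D_along M X p p)" for p
    define h where "h p = \<alpha> * (\<alpha> / 4 * w p - 1 / 2 * d p)" for p
    have DX: "(X has_derivative D_along M X p) (at p within M)" if "p \<in> M" for p
      using C_along_1_has_derivative[OF C1 that] .
    have nz: "p \<noteq> 0" if "p \<in> M" for p using that M0 by auto
    have cont_w: "continuous_on M w"
      unfolding w_def using nz by (intro continuous_intros C_along_1_continuous_on[OF C1]) auto
    have cont_d: "continuous_on M d"
      unfolding d_def using nz
      by (intro continuous_intros cont_w C_along_1_continuous_on[OF C1] continuous_on_radial_D_along[OF C1 rad]) auto
    have deriv_w: "((\<lambda>t. w (t *\<^sub>R p)) has_real_derivative d p) (at 1)" if p: "p \<in> M" for p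
    proof -
      let ?D = "\<lambda>v. norm p powr (\<alpha> - 2) * (X p \<bullet> D_along M X p v + D_along M X p v \<bullet> X p)
          + (\<alpha> - 2) * norm p powr (\<alpha> - 2 - 2) * (p \<bullet> v) * (X p \<bullet> X p)"
      have "(w has_derivative ?D) (at p within M)"
        unfolding w_def
        by (rule has_derivative_mult[OF has_derivative_at_withinI[OF has_derivative_norm_powr[OF nz[OF p]]]
              has_derivative_inner[OF DX[OF p] DX[OF p]]])
      then have "((\<lambda>t. w ((t + 1) *\<^sub>R p)) has_vector_derivative ?D p) (at 0)"
        by (rule has_derivative_within_curve[OF _ _ radial_curve zero_less_one radial_in[OF p]]) simp
      moreover have "norm p powr (\<alpha> - 2 - 2) * (p \<bullet> p) = norm p powr (\<alpha> - 2)"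
        by (rule norm_powr_mult_inner_self[OF nz[OF p]])
      then have "?D p = d p"
        unfolding d_def w_def by (simp add: inner_commute algebra_simps)
      ultimately have "((\<lambda>t. w ((t + 1) *\<^sub>R p)) has_real_derivative d p) (at 0)"
        by (simp add: has_real_derivative_iff_has_vector_derivative)
      then show ?thesis using DERIV_shift[of "\<lambda>t. w (t *\<^sub>R p)" "d p" 0 1] by simp
    qed
    have fin: "emeasure ?H K < \<infinity>" if "compact K" "K \<subseteq> M" for K
      using emeasure_compact_submanifold_finite[OF sub one_two that bM] .
    have w0: "w p = 0" if "p \<in> M - K" for p using K(3)[OF that] by (simp add: w_def)
    have w_nn: "0 \<le> w p" for p by (simp add: w_def)
    note ibp = cone_integral_radial_derivative[OF bM cone fin K(1,2) w0 w_nn cont_w cont_d deriv_w]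
    have h_int: "set_integrable ?H M h"
      unfolding h_def using ibp(1,2) by (intro set_integrable_mult_right set_integral_diff(1)) auto
    have "(LINT p:M|?H. h p) = \<alpha> * (\<alpha> / 4 * (LINT p:M|?H. w p) - 1 / 2 * (LINT p:M|?H. d p))"
      unfolding h_def using ibp(1,2)
      by (simp only: set_integral_mult_right set_integral_diff(2) set_integrable_mult_right)
    \<comment> \<open>Here the sign of \<open>\<alpha>\<close> enters: both contributions in the
      bracket are nonnegative, and so is the outer factor.\<close>
    moreover have "0 \<le> \<alpha> / 4 * (LINT p:M|?H. w p)" using \<alpha> ibp(4) by simp
    then have "0 \<le> \<alpha> * (\<alpha> / 4 * (LINT p:M|?H. w p) - 1 / 2 * (LINT p:M|?H. d p))"
      using \<alpha> ibp(3) by (intro mult_nonneg_nonneg) auto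
    ultimately have h_nn: "0 \<le> (LINT p:M|?H. h p)" by simp
    have "normal_test_field M Y"
      unfolding normal_test_field_def
    proof (intro conjI ballI)
      show "C_along 1 Y M" unfolding Y_def by (rule C_along_norm_powr_scaleR[OF C1 M0])
      show "Y p \<in> normal_space M p" if "p \<in> M" for p
        unfolding Y_def using N[OF that] by (intro subspace_scale subspace_normal_space)
      show "\<exists>K. compact K \<and> K \<subseteq> M - {0} \<and> (\<forall>p\<in>M - K. Y p = 0)"
        using K M0 by (intro exI[of _ K]) (auto simp: Y_def)
    qed
    then have stable_Y: "(LINT p:M|?H. 1 * ((\<Sum>e\<in>tangent_frame M p. \<Sum>e'\<in>tangent_frame M p.
            (second_ff M p e e' \<bullet> Y p)\<^sup>2) + (mean_curvature M p \<bullet> Y p)\<^sup>2))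
        \<le> (LINT p:M|?H. 1 * (\<Sum>e\<in>tangent_frame M p. (norm (normal_proj M p (D_along M Y p e)))\<^sup>2)
            + hessian (\<lambda>_. 1) p (Y p) (Y p))"
      using stable unfolding f_stable_def by blast
    have "(LINT p:M|?H. ?f p * ((\<Sum>e\<in>tangent_frame M p. \<Sum>e'\<in>tangent_frame M p.
            (second_ff M p e e' \<bullet> X p)\<^sup>2) + (mean_curvature M p \<bullet> X p)\<^sup>2))
        = (LINT p:M|?H. 1 * ((\<Sum>e\<in>tangent_frame M p. \<Sum>e'\<in>tangent_frame M p.
            (second_ff M p e e' \<bullet> Y p)\<^sup>2) + (mean_curvature M p \<bullet> Y p)\<^sup>2))"
    proof -
      have "(v \<bullet> Y p)\<^sup>2 = ?f p * (v \<bullet> X p)\<^sup>2" for v p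
        by (simp add: Y_def power_mult_distrib power2_eq_square[of "_ powr _"] flip: powr_add)
      then show ?thesis by (simp add: sum_distrib_left distrib_left)
    qed
    also note stable_Y
    also have "(LINT p:M|?H. 1 * (\<Sum>e\<in>tangent_frame M p. (norm (normal_proj M p (D_along M Y p e)))\<^sup>2)
            + hessian (\<lambda>_. 1) p (Y p) (Y p))
        \<le> (LINT p:M|?H. ?f p * (\<Sum>e\<in>tangent_frame M p. (norm (normal_proj M p (D_along M X p e)))\<^sup>2)
            + hessian ?f p (X p) (X p))"
    proof (rule set_integral_add_nonneg_le[OF _ h_int h_nn])
      fix p assume p: "p \<in> M"
      have "p \<bullet> X p = 0" using N[OF p] rad[OF p] by (auto simp: normal_space_def inner_commute)
      then have "hessian ?f p (X p) (X p) = \<alpha> * w p"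
        using nz[OF p] by (simp add: hessian_norm_powr w_def)
      moreover have "hessian (\<lambda>_. 1) p (Y p) (Y p) = 0"
        by (simp add: hessian_def frechet_derivative_const)
      moreover have "(\<Sum>e\<in>tangent_frame M p. (norm (normal_proj M p (D_along M Y p e)))\<^sup>2) =
          ?f p * (\<Sum>e\<in>tangent_frame M p. (norm (normal_proj M p (D_along M X p e)))\<^sup>2)
          + \<alpha> * norm p powr (\<alpha> - 2) * (X p \<bullet> D_along M X p p) + (\<alpha> / 2)\<^sup>2 * w p"
        using sum_normal_derivative_norm_powr_scaled[OF T[OF p] rad[OF p] nz[OF p] DX[OF p] N[OF p], of "\<alpha> / 2"]
        by (simp add: Y_def[abs_def] w_def mult.assoc)
      \<comment> \<open>Since \<open>X p\<close> is orthogonal to \<open>p\<close>, the Hessian is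
        \<open>\<alpha> * w p\<close>. It cancels when the radial derivative of \<open>X\<close> is
        eliminated in favour of \<open>d\<close>, and the remaining multiples of \<open>w\<close>
        are \<open>\<alpha>\<^sup>2 / 2 - \<alpha>\<^sup>2 / 4\<close>.\<close>
      ultimately show "?f p * (\<Sum>e\<in>tangent_frame M p. (norm (normal_proj M p (D_along M X p e)))\<^sup>2)
            + hessian ?f p (X p) (X p) =
          1 * (\<Sum>e\<in>tangent_frame M p. (norm (normal_proj M p (D_along M Y p e)))\<^sup>2)
            + hessian (\<lambda>_. 1) p (Y p) (Y p) + h p"
        by (simp add: h_def d_def power2_eq_square algebra_simps)
    qed (use bM in simp)
    finally show ?thesis .
  qed
  ultimately show ?thesis unfolding f_stable_def by blast
qed

text \<open>As a preimage under radial projection the punctured cone is visibly Borel and dilation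
  invariant. The origin is excluded automatically: division by zero sends it to 0, which is not on
  the sphere.\<close>

lemma cone_over_minus_origin:
  assumes "\<Sigma> \<subseteq> sphere 0 1"
  shows "cone_over \<Sigma> - {0} = (\<lambda>p. p /\<^sub>R norm p) -` \<Sigma>"
proof (intro equalityI subsetI)
  fix p assume "p \<in> cone_over \<Sigma> - {0}"
  then obtain t x where tx: "p = t *\<^sub>R x" "t > 0" "x \<in> \<Sigma>"
    by (auto simp: cone_over_def less_le)
  then have "norm x = 1" using assms by auto
  then show "p \<in> (\<lambda>p. p /\<^sub>R norm p) -` \<Sigma>" using tx by simp
next
  fix p assume p: "p \<in> (\<lambda>p. p /\<^sub>R norm p) -` \<Sigma>"
  then have "p \<noteq> 0" using assms by auto
  then show "p \<in> cone_over \<Sigma> - {0}"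
    using p \<open>p \<noteq> 0\<close> unfolding cone_over_def
    by (intro DiffI CollectI exI[of _ "norm p"] exI[of _ "p /\<^sub>R norm p"]) auto
qed

theorem corollary1p9:
  fixes \<alpha> :: real and C :: "(real ^ 'n) set" and \<nu> :: "real ^ 'n \<Rightarrow> real ^ 'n"
  assumes "\<alpha> \<ge> 0"
    and "minimal_hypercone C"
    and oriented: "unit_normal_field (C - {0}) \<nu>"
    and "area_stable (CARD('n) - 1) (C - {0})"
  shows "f_stable (CARD('n) - 1) (\<lambda>x. norm x powr \<alpha>) (C - {0})"
proof -
  obtain \<Sigma> where \<Sigma>: "compact \<Sigma>" "\<Sigma> \<subseteq> sphere 0 1" "C = cone_over \<Sigma>"
    using assms(2) by (auto simp: minimal_hypercone_def)
  then have eq: "C - {0} = (\<lambda>p. p /\<^sub>R norm p) -` \<Sigma>"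
    by (simp add: cone_over_minus_origin)
  \<comment> \<open>Radial projection is discontinuous at the origin but still Borel.\<close>
  have "(\<lambda>p :: real ^ 'n. p /\<^sub>R norm p) \<in> borel_measurable borel" by measurable
  moreover have "\<Sigma> \<in> sets borel" using \<Sigma>(1) by (simp add: compact_imp_closed)
  ultimately have "(\<lambda>p. p /\<^sub>R norm p) -` \<Sigma> \<inter> space borel \<in> sets borel"
    by (rule measurable_sets)
  then have "C - {0} \<in> sets borel" by (simp add: eq)
  moreover have "t *\<^sub>R p \<in> C - {0} \<longleftrightarrow> p \<in> C - {0}" if "t > 0" for t p
  proof -
    have "(t *\<^sub>R p) /\<^sub>R norm (t *\<^sub>R p) = p /\<^sub>R norm p"
      using that by (simp add: field_simps)
    then show ?thesis by (simp only: eq vimage_def mem_Collect_eq)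
  qed
  ultimately show ?thesis
    using assms(1,4) by (intro f_stable_norm_powr_cone) auto
qed

end
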